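(* Let $\Omega\subset\mathbb H\cong\mathbb R^4$ be a domain and let $q=(q_0,q_1,q_2,q_3)\in\mathbb R^4$. Then $CB_q(\Omega)$ is a real Banach space and there exists a four-tuple of real-valued reproducing functions, denoted by $(B_0(x,\cdot),B_1(x,\cdot),B_2(x,\cdot),B_3(x,\cdot))\in CB_q(\Omega)$, such that $$\langle(B_0(x,\cdot),-B_1(x,\cdot),-B_2(x,\cdot),-B_3(x,\cdot)),\ (f_0,f_1,f_2,f_3)\rangle_{CB_q(\Omega)}=(f_0(x),f_1(x),f_2(x),f_3(x)),$$ or equivalently $$\int_\Omega\left(B_0(x,y)f_0(y)-B_1(x,y)f_1(y)-B_2(x,y)f_2(y)-B_3(x,y)f_3(y)\right)d\mu_y=f_0(x),$$ $$\int_\Omega\left(B_0(x,y)f_1(y)+B_1(x,y)f_0(y)+B_2(x,y)f_3(y)-B_3(x,y)f_2(y)\right)d\mu_y=f_1(x),$$ $$\int_\Omega\left(B_0(x,y)f_2(y)-B_1(x,y)f_3(y)+B_2(x,y)f_0(y)+B_3(x,y)f_1(y)\right)d\mu_y=f_2(x),$$ $$\int_\Omega\left(B_0(x,y)f_3(y)+B_1(x,y)f_2(y)-B_2(x,y)f_1(y)+B_3(x,y)f_0(y)\right)d\mu_y=f_3(x),$$ for all $f=(f_0,f_1,f_2,f_3)\in CB_q(\Omega)$ (and $x\in\Omega$). Additionally, if $g_k:\Omega\to\mathbb R$ is a measurable function and $\int_\Omega|g_k|^2d\mu<\infty$ for $k=0,1,2,3$, then the four-tuple of real-valued functions $$(h_0(x),h_1(x),h_2(x),h_3(x))=\langle(B_0(x,\cdot),-B_1(x,\cdot),-B_2(x,\cdot),-B_3(x,\cdot)),\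 (g_0,g_1,g_2,g_3)\rangle_{CB_q(\Omega)},\qquad x\in\Omega,$$ belongs to $CB_q(\Omega)$.
   Context: $\mathbb H\cong\mathbb R^4$ denotes the quaternions and $\mu$ is the volume measure on $\Omega$. $CB_q(\Omega)$ is the set of four-tuples $f=(f_0,f_1,f_2,f_3)$ of functions in $C^1(\Omega,\mathbb R)$ with $\int_\Omega|f_k|^2d\mu<\infty$ for $k=0,1,2,3$ that satisfy on $\Omega$ the inhomogeneous Cimmino system $$\begin{cases} \dfrac{\partial f_0}{\partial x_0}+\dfrac{\partial f_2}{\partial x_2}-\dfrac{\partial f_1}{\partial x_1}-\dfrac{\partial f_3}{\partial x_3}=q_0f_0+q_2f_2-q_1f_1-q_3f_3\\[2mm] \dfrac{\partial f_0}{\partial x_1}+\dfrac{\partial f_1}{\partial x_0}-\dfrac{\partial f_2}{\partial x_3}+\dfrac{\partial f_3}{\partial x_2}=q_1f_0+q_0f_1-q_3f_2+q_2f_3\\[2mm] \dfrac{\partial f_0}{\partial x_2}+\dfrac{\partial f_3}{\partial x_1}-\dfrac{\partial f_1}{\partial x_3}-\dfrac{\partial f_2}{\partial x_0}=q_2f_0+q_1f_3-q_3f_1-q_0f_2\\[2mm] \dfrac{\partial f_0}{\partial x_3}+\dfrac{\partial f_1}{\partial x_2}+\dfrac{\partial f_2}{\partial x_1}+\dfrac{\partial f_3}{\partial x_0}=q_3f_0+q_2f_1+q_1f_2+q_0f_3. \end{cases}$$ It carries the norm $\|f\|_{CB_q(\Omega)}=\left[\int_\Omega(f_0^2+f_1^2+f_2^2+f_3^2)\,d\mu\right]^{1/2}$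 and the $\mathbb R^4$-valued real-bilinear form $$\langle f,g\rangle_{CB_q(\Omega)}=\Big(\int_\Omega(f_0g_0+f_1g_1+f_2g_2+f_3g_3)\,d\mu,\ \int_\Omega(f_0g_1-f_1g_0+f_2g_3-f_3g_2)\,d\mu,$$ $$\int_\Omega(f_0g_2+f_3g_1-f_1g_3-f_2g_0)\,d\mu,\ \int_\Omega(f_0g_3-f_1g_2+f_2g_1-f_3g_0)\,d\mu\Big),$$ the same expression being used for the four-tuples of square-integrable functions occurring in the claim.
   Formalization: In the second equation ∂f3/∂x2 and q2f3 carry the sign −; components 1, 2 of the form are ∫(f0g1−f1g0−f2g3+f3g2), ∫(f0g2−f3g1+f1g3−f2g0); instead of (B0,B1,B2,B3)(x,·)∈CB_q: (B0,−B1,−B2,−B3)(x,·)∈CB_q and (B0,B1,B2,B3)(·,y)∈CB_q. *)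

theory Defs
  imports "HOL-Analysis.Analysis"
begin

text \<open>
  The index type \<^typ>\<open>4\<close> consists of \<open>0, 1, 2, 3\<close> (arithmetic modulo 4), so \<open>x $ 0, \<dots>, x $ 3\<close> are
  the coordinates \<open>x\<^sub>0, \<dots>, x\<^sub>3\<close>, and a four-tuple is a function on \<^typ>\<open>4\<close>.
\<close>

definition tuple4 :: "'a \<Rightarrow> 'a \<Rightarrow> 'a \<Rightarrow> 'a \<Rightarrow> 4 \<Rightarrow> 'a" where
  "tuple4 a b c d k = (if k = 0 then a else if k = 1 then b else if k = 2 then c else d)"

lemma tuple4_simps [simp]:
  "tuple4 a b c d 0 = a" "tuple4 a b c d 1 = b" "tuple4 a b c d 2 = c" "tuple4 a b c d 3 = d"
  by (simp_all add: tuple4_def)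

definition pd :: "4 \<Rightarrow> (real^4 \<Rightarrow> real) \<Rightarrow> real^4 \<Rightarrow> real" where
  "pd i u x = frechet_derivative u (at x) (axis i 1)"

definition C1_on :: "(real^4) set \<Rightarrow> (real^4 \<Rightarrow> real) \<Rightarrow> bool" where
  "C1_on \<Omega> u \<longleftrightarrow> (\<forall>x\<in>\<Omega>. u differentiable (at x)) \<and> (\<forall>i. continuous_on \<Omega> (pd i u))"

definition square_integrable_on :: "(real^4) set \<Rightarrow> (real^4 \<Rightarrow> real) \<Rightarrow> bool" where
  "square_integrable_on \<Omega> u \<longleftrightarrow>
     u \<in> borel_measurable (lebesgue_on \<Omega>) \<and> integrable (lebesgue_on \<Omega>) (\<lambda>x. \<bar>u x\<bar>\<^sup>2)"

text \<open>
  With \<open>f = f\<^sub>0 + f\<^sub>1 i + f\<^sub>2 j + f\<^sub>3 k\<close> the system reads \<open>D f = (q\<^sub>0 + q\<^sub>1 i - q\<^sub>2 j + q\<^sub>3 k) f\<close>,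
  where \<open>D = \<partial>\<^sub>0 + i \<partial>\<^sub>1 - j \<partial>\<^sub>2 + k \<partial>\<^sub>3\<close> acts from the left; the four equations are the components
  \<open>1\<close>, \<open>i\<close>, \<open>-j\<close> and \<open>k\<close>. Note the sign of \<open>\<partial>\<^sub>2 f\<^sub>3\<close> and \<open>q\<^sub>2 f\<^sub>3\<close> in the second equation. With
  \<open>+\<close> there, a misprint, the system would not be elliptic: for \<open>q = 0\<close> it would be solved by
  \<open>\<phi> (x\<^sub>0 + x\<^sub>2) (0, 1, 0, -1)\<close> for every \<open>\<phi>\<close> of class \<open>C\<^sup>1\<close>, so on a ball the space of its
  square-integrable solutions is not complete and has unbounded point evaluations.
\<close>

definition cimmino_system :: "real^4 \<Rightarrow> (real^4) set \<Rightarrow> (4 \<Rightarrow> real^4 \<Rightarrow> real) \<Rightarrow> bool" where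
  "cimmino_system q \<Omega> f \<longleftrightarrow> (\<forall>x\<in>\<Omega>.
     pd 0 (f 0) x + pd 2 (f 2) x - pd 1 (f 1) x - pd 3 (f 3) x
       = q$0 * f 0 x + q$2 * f 2 x - q$1 * f 1 x - q$3 * f 3 x \<and>
     pd 1 (f 0) x + pd 0 (f 1) x - pd 3 (f 2) x - pd 2 (f 3) x
       = q$1 * f 0 x + q$0 * f 1 x - q$3 * f 2 x - q$2 * f 3 x \<and>
     pd 2 (f 0) x + pd 1 (f 3) x - pd 3 (f 1) x - pd 0 (f 2) x
       = q$2 * f 0 x + q$1 * f 3 x - q$3 * f 1 x - q$0 * f 2 x \<and>
     pd 3 (f 0) x + pd 2 (f 1) x + pd 1 (f 2) x + pd 0 (f 3) x
       = q$3 * f 0 x + q$2 * f 1 x + q$1 * f 2 x + q$0 * f 3 x)"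

text \<open>
  A function on \<open>\<Omega>\<close> is represented by its extension by \<open>0\<close>; this makes equality of
  representatives coincide with equality on \<open>\<Omega>\<close>.
\<close>

definition CB :: "real^4 \<Rightarrow> (real^4) set \<Rightarrow> (4 \<Rightarrow> real^4 \<Rightarrow> real) set" where
  "CB q \<Omega> = {f. (\<forall>k. C1_on \<Omega> (f k)) \<and> (\<forall>k. square_integrable_on \<Omega> (f k)) \<and>
               cimmino_system q \<Omega> f \<and> (\<forall>k x. x \<notin> \<Omega> \<longrightarrow> f k x = 0)}"

definition CB_norm :: "(real^4) set \<Rightarrow> (4 \<Rightarrow> real^4 \<Rightarrow> real) \<Rightarrow> real" where
  "CB_norm \<Omega> f =
     sqrt (LINT x|lebesgue_on \<Omega>. (f 0 x)\<^sup>2 + (f 1 x)\<^sup>2 + (f 2 x)\<^sup>2 + (f 3 x)\<^sup>2)"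

text \<open>
  The four components of \<open>\<integral> f\<^sup>* g\<close>, where \<open>f\<^sup>*\<close> is the quaternionic conjugate of \<open>f\<close>. These are
  the signs for which pairing with \<open>(B\<^sub>0, -B\<^sub>1, -B\<^sub>2, -B\<^sub>3)\<close> gives the components of \<open>\<integral> B g\<close>.
\<close>

definition CB_form ::
  "(real^4) set \<Rightarrow> (4 \<Rightarrow> real^4 \<Rightarrow> real) \<Rightarrow> (4 \<Rightarrow> real^4 \<Rightarrow> real) \<Rightarrow> 4 \<Rightarrow> real" where
  "CB_form \<Omega> f g = tuple4
     (LINT x|lebesgue_on \<Omega>. f 0 x * g 0 x + f 1 x * g 1 x + f 2 x * g 2 x + f 3 x * g 3 x)
     (LINT x|lebesgue_on \<Omega>. f 0 x * g 1 x - f 1 x * g 0 x - f 2 x * g 3 x + f 3 x * g 2 x)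
     (LINT x|lebesgue_on \<Omega>. f 0 x * g 2 x - f 3 x * g 1 x + f 1 x * g 3 x - f 2 x * g 0 x)
     (LINT x|lebesgue_on \<Omega>. f 0 x * g 3 x - f 1 x * g 2 x + f 2 x * g 1 x - f 3 x * g 0 x)"

text \<open>Vector space operations on four-tuples of functions are pointwise.\<close>

definition real_banach_space ::
  "(4 \<Rightarrow> real^4 \<Rightarrow> real) set \<Rightarrow> ((4 \<Rightarrow> real^4 \<Rightarrow> real) \<Rightarrow> real) \<Rightarrow> bool" where
  "real_banach_space V N \<longleftrightarrow>
     (\<lambda>k x. 0) \<in> V \<and>
     (\<forall>f\<in>V. \<forall>g\<in>V. (\<lambda>k x. f k x + g k x) \<in> V) \<and>
     (\<forall>c. \<forall>f\<in>V. (\<lambda>k x. c * f k x) \<in> V) \<and>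
     (\<forall>f\<in>V. 0 \<le> N f) \<and>
     (\<forall>f\<in>V. N f = 0 \<longleftrightarrow> f = (\<lambda>k x. 0)) \<and>
     (\<forall>c. \<forall>f\<in>V. N (\<lambda>k x. c * f k x) = \<bar>c\<bar> * N f) \<and>
     (\<forall>f\<in>V. \<forall>g\<in>V. N (\<lambda>k x. f k x + g k x) \<le> N f + N g) \<and>
     (\<forall>s. (\<forall>n. s n \<in> V) \<and>
          (\<forall>e>0. \<exists>M. \<forall>m\<ge>M. \<forall>n\<ge>M. N (\<lambda>k x. s m k x - s n k x) < e) \<longrightarrow>
          (\<exists>f\<in>V. (\<lambda>n::nat. N (\<lambda>k x. s n k x - f k x)) \<longlonglongrightarrow> 0))"

end

theory Submission
  imports Defs
begin

text \<open>
  The system says \<open>D f = q' f\<close> with \<open>D = \<partial>\<^sub>0 + i \<partial>\<^sub>1 - j \<partial>\<^sub>2 + k \<partial>\<^sub>3\<close> and \<open>q' = q\<^sub>0 + q\<^sub>1 i - q\<^sub>2 j + q\<^sub>3 k\<close>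
  acting from the left. Two consequences carry the proof. Solutions form a right module over the
  quaternions, and \<open>f\<close> is a solution exactly if \<open>g = exp (- q \<bullet> x) f\<close> satisfies \<open>D g = 0\<close>.

  Everything analytic follows from one mean value formula. For \<open>D g = 0\<close> and a radial weight \<open>w\<close> the
  integral \<open>H t = \<integral> w y * g (x + t y) dy\<close> does not depend on \<open>t\<close>: multiplying \<open>D g = 0\<close> from the left by
  the conjugate of \<open>y\<^sub>0 + y\<^sub>1 i - y\<^sub>2 j + y\<^sub>3 k\<close> writes the radial derivative of \<open>g\<close> as a combination of
  the rotational derivatives \<open>y\<^sub>i \<partial>\<^sub>j - y\<^sub>j \<partial>\<^sub>i\<close>, and these integrate to zero against a radial weight
  (\<open>integral_bump_rotation_eq_0\<close>). Comparing \<open>t = r\<close> with \<open>t = 0\<close> gives \<open>mean_value\<close>. Only first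
  derivatives of \<open>g\<close> enter the computation. Undoing the exponential yields a \<open>C\<^sup>1\<close> kernel \<open>\<Phi>\<close> of
  compact support, the same for all solutions, with
  \<open>f x = \<integral> \<Phi> (y - x) f y dy\<close> away from the boundary (\<open>mollifier_reproduces\<close>).

  By the Cauchy-Schwarz inequality this formula bounds point evaluations by the norm. A Cauchy
  sequence of solutions therefore converges pointwise; Fatou's lemma makes the limit square-integrable
  and the convergence one in norm; the formula passes to the limit, so the limit is \<open>C\<^sup>1\<close>, and since
  its partial derivatives are integrals against \<open>\<nabla>\<Phi>\<close> they are the limits of the partial derivatives of
  the sequence. Hence the system survives (\<open>CB_complete\<close>).

  So the space is a closed subspace of a Hilbert space and has an orthogonal projection
  \<open>P\<close>, which is quaternionic because the subspace is a right module. The element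
  \<open>K\<^sub>x = P (\<Phi> (\<cdot> - x))\<close> satisfies \<open>\<integral> K\<^sub>x\<^sup>* f = f x\<close> for all solutions, where \<open>K\<^sub>x\<^sup>*\<close> is the quaternionic
  conjugate; \<open>B x y\<close> is the conjugate of \<open>K\<^sub>x y\<close>. The conjugate symmetry of the form gives
  \<open>B x y = K\<^sub>y x\<close>, so \<open>B\<close> is a solution in its first argument too. For square-integrable
  \<open>g\<close>, pairing with \<open>K\<^sub>x\<close> does not distinguish \<open>g\<close> from \<open>P g\<close>, so the function \<open>h\<close> of the theorem is
  \<open>P g\<close>.
\<close>

section \<open>A radial bump function\<close>

lemma real_derivative_pos_part_square:
  "((\<lambda>s::real. (max 0 s)\<^sup>2) has_real_derivative 2 * max 0 s) (at s)"
proof -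
  have lt: "((\<lambda>s::real. (max 0 s)\<^sup>2) has_real_derivative 2 * max 0 s) (at s)" if "s < 0"
  proof (rule has_field_derivative_transform_within_open[where f="\<lambda>_. 0" and S="{..<0}"])
    show "((\<lambda>_. 0::real) has_real_derivative 2 * max 0 s) (at s)" using that by simp
  qed (use that in auto)
  have gt: "((\<lambda>s::real. (max 0 s)\<^sup>2) has_real_derivative 2 * max 0 s) (at s)" if "s > 0"
  proof (rule has_field_derivative_transform_within_open[where f="\<lambda>s. s\<^sup>2" and S="{0<..}"])
    show "((\<lambda>s. s\<^sup>2) has_real_derivative 2 * max 0 s) (at s)"
      using that by (auto intro!: derivative_eq_intros)
  qed (use that in auto)
  have eq: "((\<lambda>s::real. (max 0 s)\<^sup>2) has_real_derivative 0) (at 0)"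
  proof -
    have "((\<lambda>h::real. ((max 0 h)\<^sup>2) / h) \<longlongrightarrow> 0) (at 0)"
    proof (rule Lim_null_comparison)
      show "\<forall>\<^sub>F h in at (0::real). norm ((max 0 h)\<^sup>2 / h) \<le> \<bar>h\<bar>"
        by (intro always_eventually) (auto simp: max_def power2_eq_square)
      show "((\<lambda>h::real. \<bar>h\<bar>) \<longlongrightarrow> 0) (at 0)"
        by (rule tendsto_eq_intros | simp)+
    qed
    then show ?thesis by (simp add: DERIV_def)
  qed
  consider "s < 0" | "s > 0" | "s = 0" by linarith
  then show ?thesis using lt gt eq by cases auto
qed

text \<open>
  A polynomial weight inside the unit ball, squared to make it \<open>C\<^sup>1\<close> across the sphere. Its gradient
  is parallel to \<open>y\<close>, as for every radial function.
\<close>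

definition bump :: "real^4 \<Rightarrow> real" where
  "bump y = (max 0 (1 - y \<bullet> y))\<^sup>2"

definition bump_grad :: "real^4 \<Rightarrow> real^4" where
  "bump_grad y = (- 4 * max 0 (1 - y \<bullet> y)) *\<^sub>R y"

lemma bump_has_derivative: "(bump has_derivative (\<lambda>h. bump_grad y \<bullet> h)) (at y)"
proof -
  have 1: "((\<lambda>y. 1 - y \<bullet> y) has_derivative (\<lambda>h. - 2 * (y \<bullet> h))) (at y)"
    by (auto intro!: derivative_eq_intros simp: inner_commute)
  have 2: "((\<lambda>s::real. (max 0 s)\<^sup>2) has_derivative (\<lambda>t. 2 * max 0 (1 - y \<bullet> y) * t)) (at (1 - y \<bullet> y))"
    using real_derivative_pos_part_square[of "1 - y \<bullet> y"] by (simp add: has_field_derivative_def)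
  show ?thesis
    using has_derivative_compose[OF 1 2] by (simp add: bump_def[abs_def] bump_grad_def algebra_simps)
qed

lemma continuous_on_bump [continuous_intros]:
  "continuous_on S f \<Longrightarrow> continuous_on S (\<lambda>x. bump (f x))"
  unfolding bump_def by (intro continuous_intros)

lemma continuous_on_bump_grad [continuous_intros]:
  "continuous_on S f \<Longrightarrow> continuous_on S (\<lambda>x. bump_grad (f x))"
  unfolding bump_grad_def by (intro continuous_intros)

lemma inner_self_ge_1: "norm (y::real^4) \<ge> 1 \<Longrightarrow> 1 \<le> y \<bullet> y"
  by (metis one_le_power power2_norm_eq_inner)

lemma bump_eq_0 [simp]: "norm y \<ge> 1 \<Longrightarrow> bump y = 0" and
  bump_grad_eq_0 [simp]: "norm y \<ge> 1 \<Longrightarrow> bump_grad y = 0"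
  using inner_self_ge_1[of y] by (auto simp: bump_def bump_grad_def)

lemma bump_nonneg: "0 \<le> bump y" and bump_0: "bump 0 = 1"
  by (auto simp: bump_def)

section \<open>Integration by parts and rotation fields\<close>

lemma mem_cube_iff:
  "y \<in> cbox (- a *\<^sub>R One) (a *\<^sub>R One) \<longleftrightarrow> (\<forall>b\<in>Basis. \<bar>y \<bullet> b\<bar> \<le> a)"
proof -
  have "- a \<le> t \<and> t \<le> a \<longleftrightarrow> \<bar>t\<bar> \<le> a" for t :: real by linarith
  then show ?thesis by (simp add: mem_box)
qed

lemma norm_le_cube:
  fixes y :: "real^4"
  assumes "y \<in> cbox (- a *\<^sub>R One) (a *\<^sub>R One)"
  shows "norm y \<le> 4 * a"
proof -
  have "norm y \<le> (\<Sum>b\<in>Basis. \<bar>y \<bullet> b\<bar>)" by (rule norm_le_l1)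
  also have "\<dots> \<le> (\<Sum>b\<in>(Basis::(real^4) set). a)"
    using assms unfolding mem_cube_iff by (intro sum_mono) simp
  also have "\<dots> = 4 * a" by simp
  finally show ?thesis .
qed

lemma cball_subset_cube: "cball 0 a \<subseteq> cbox (- a *\<^sub>R One) (a *\<^sub>R One)"
proof
  fix y :: 'a assume "y \<in> cball 0 a"
  then show "y \<in> cbox (- a *\<^sub>R One) (a *\<^sub>R One)"
    unfolding mem_cube_iff using Basis_le_norm[of _ y] by force
qed

lemma integral_eq_UNIV_of_support:
  fixes u :: "real^4 \<Rightarrow> real"
  assumes "\<And>y. y \<notin> S \<Longrightarrow> u y = 0"
  shows "integral S u = integral UNIV u"
proof -
  have "u = (\<lambda>y. if y \<in> S then u y else 0)" using assms by auto
  then show ?thesis using integral_restrict_UNIV[of S u] by metis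
qed

text \<open>
  By translation invariance the integral of \<open>u (y + s e)\<close> does not depend on \<open>s\<close>; differentiate under
  the integral sign at \<open>s = 0\<close>. The larger cube leaves room for translations with \<open>|s| < 1\<close>.
\<close>

lemma integral_directional_derivative_eq_0:
  fixes u :: "real^4 \<Rightarrow> real" and u' :: "real^4 \<Rightarrow> real^4 \<Rightarrow> real"
  assumes der: "\<And>y. (u has_derivative u' y) (at y)"
    and cont: "continuous_on UNIV (\<lambda>y. u' y e)"
    and supp: "\<And>y. norm y > 1 \<Longrightarrow> u y = 0" "\<And>y. norm y > 1 \<Longrightarrow> u' y e = 0"
    and e: "norm e = 1"
  shows "integral (cbox (-One) One) (\<lambda>y. u' y e) = 0"
proof -
  let ?a = "- 2 *\<^sub>R One :: real^4" and ?b = "2 *\<^sub>R One :: real^4"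
  define F where "F s = integral (cbox ?a ?b) (\<lambda>y. u (y + s *\<^sub>R e))" for s
  have ucont: "continuous_on S u" for S
    by (intro continuous_at_imp_continuous_on ballI has_derivative_continuous[OF der])
  have "(F has_field_derivative integral (cbox ?a ?b) (\<lambda>y. u' (y + 0 *\<^sub>R e) e)) (at 0 within {-1<..<1})"
    unfolding F_def
  proof (rule leibniz_rule_field_derivative)
    fix s :: real and y :: "real^4"
    have "((\<lambda>s. u (y + s *\<^sub>R e)) has_derivative (\<lambda>t. u' (y + s *\<^sub>R e) (t *\<^sub>R e))) (at s within {-1<..<1})"
      by (rule has_derivative_compose[OF _ der]) (auto intro!: derivative_eq_intros)
    moreover have "(\<lambda>t. u' (y + s *\<^sub>R e) (t *\<^sub>R e)) = (*) (u' (y + s *\<^sub>R e) e)"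
      using linear_cmul[OF has_derivative_linear[OF der]] by (simp add: fun_eq_iff)
    ultimately show "((\<lambda>s. u (y + s *\<^sub>R e)) has_field_derivative u' (y + s *\<^sub>R e) e) (at s within {-1<..<1})"
      by (simp only: has_field_derivative_def)
  next
    show "(\<lambda>y. u (y + s *\<^sub>R e)) integrable_on cbox ?a ?b" for s
      by (intro integrable_continuous continuous_on_compose2[OF ucont[of UNIV]] continuous_intros) auto
    show "continuous_on ({-1<..<1} \<times> cbox ?a ?b) (\<lambda>(s, y). u' (y + s *\<^sub>R e) e)"
      by (auto simp: split_beta intro!: continuous_on_compose2[OF cont] continuous_intros)
  next
    show "convex {-1<..<1::real}" by (rule convex_real_interval)
  qed simp
  then have "(F has_field_derivative integral (cbox ?a ?b) (\<lambda>y. u' y e)) (at 0)"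
    by (simp add: at_within_open[of 0 "{-1<..<1::real}"])
  moreover have const: "F s = integral UNIV u" if "s \<in> {-1<..<1}" for s
  proof -
    have "F s = integral (cbox (?a + s *\<^sub>R e) (?b + s *\<^sub>R e)) u"
      unfolding F_def using integral_shift_cbox_plus[of ?a ?b u "s *\<^sub>R e"]
      by (simp add: add.commute o_def)
    also have "\<dots> = integral UNIV u"
    proof (rule integral_eq_UNIV_of_support, rule supp, rule ccontr)
      fix y assume y: "y \<notin> cbox (?a + s *\<^sub>R e) (?b + s *\<^sub>R e)" "\<not> 1 < norm y"
      have "norm (y - s *\<^sub>R e) \<le> norm y + norm (s *\<^sub>R e)" by (rule norm_triangle_ineq4)
      also have "\<dots> \<le> 2" using y(2) that e by (auto simp: abs_if)
      finally have "y - s *\<^sub>R e \<in> cbox ?a ?b" using cball_subset_cube[of 2] by auto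
      then have "y \<in> cbox (?a + s *\<^sub>R e) (?b + s *\<^sub>R e)" by (auto simp: mem_box inner_simps algebra_simps)
      then show False using y by simp
    qed
    finally show ?thesis .
  qed
  then have "(F has_field_derivative 0) (at 0)"
    using has_field_derivative_transform_within_open[of "\<lambda>_. integral UNIV u" 0 0 "{-1<..<1}" F] by auto
  ultimately have "integral (cbox ?a ?b) (\<lambda>y. u' y e) = 0" by (rule DERIV_unique)
  moreover have "integral (cbox (- c *\<^sub>R One) (c *\<^sub>R One)) (\<lambda>y. u' y e) = integral UNIV (\<lambda>y. u' y e)"
    if "c \<ge> 1" for c
  proof (rule integral_eq_UNIV_of_support, rule supp)
    fix y assume "y \<notin> cbox (- c *\<^sub>R One) (c *\<^sub>R One :: real^4)"
    then have "y \<notin> cball 0 c" using cball_subset_cube[of c] by blast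
    then show "norm y > 1" using that by simp
  qed
  from this[of 1] this[of 2] have "integral (cbox (-One) One) (\<lambda>y. u' y e) = integral UNIV (\<lambda>y. u' y e)"
    "integral (cbox ?a ?b) (\<lambda>y. u' y e) = integral UNIV (\<lambda>y. u' y e)" by simp_all
  ultimately show ?thesis by simp
qed

lemma continuous_on_cutoff_mult:
  fixes \<phi> G :: "real^4 \<Rightarrow> real"
  assumes \<phi>: "continuous_on UNIV \<phi>" and 0: "\<And>y. norm y \<ge> 1 \<Longrightarrow> \<phi> y = 0"
    and G: "continuous_on (ball 0 R) G" and R: "R > 1"
  shows "continuous_on UNIV (\<lambda>y. \<phi> y * G y)"
proof -
  have "continuous_on (ball 0 R \<union> - cball 0 1) (\<lambda>y. \<phi> y * G y)"
  proof (rule continuous_on_open_Un)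
    show "continuous_on (ball 0 R) (\<lambda>y. \<phi> y * G y)"
      by (intro continuous_intros continuous_on_subset[OF \<phi>] G) auto
    have "continuous_on (- cball 0 1) (\<lambda>y. \<phi> y * G y) \<longleftrightarrow> continuous_on (- cball 0 1) (\<lambda>y::real^4. 0::real)"
      by (rule continuous_on_cong) (auto simp: 0)
    then show "continuous_on (- cball 0 1) (\<lambda>y. \<phi> y * G y)" by simp
  qed auto
  moreover have "ball 0 R \<union> - cball 0 1 = (UNIV :: (real^4) set)" using R by auto
  ultimately show ?thesis by simp
qed

text \<open>
  Rotation fields are divergence-free and annihilate radial functions. Concretely, the integrand
  is \<open>\<partial>\<^sub>j (y\<^sub>i w G) - \<partial>\<^sub>i (y\<^sub>j w G)\<close> with \<open>w = bump\<close>: the terms containing the gradient of \<open>w\<close> cancel since that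
  gradient is a multiple of \<open>y\<close>.
\<close>

lemma integral_bump_rotation_eq_0:
  fixes G :: "real^4 \<Rightarrow> real" and G' :: "real^4 \<Rightarrow> real^4"
  assumes der: "\<And>y. norm y < R \<Longrightarrow> (G has_derivative (\<lambda>h. G' y \<bullet> h)) (at y)"
    and cont: "continuous_on (ball 0 R) G'" and R: "R > 1" and ij: "i \<noteq> j"
  shows "((\<lambda>y. bump y * (y $ i * G' y $ j - y $ j * G' y $ i)) has_integral 0) (cbox (-One) One)"
proof -
  have Gc: "continuous_on (ball 0 R) G"
    using der has_derivative_continuous by (intro continuous_at_imp_continuous_on) fastforce
  have main: "((\<lambda>y. (y $ a * (bump_grad y $ b)) * G y + (y $ a * bump y) * (G' y $ b)) has_integral 0)
      (cbox (-One) One)" if ab: "a \<noteq> b" for a b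
  proof -
    define u' where "u' y h = (h $ a * bump y + y $ a * (bump_grad y \<bullet> h)) * G y +
      (y $ a * bump y) * (G' y \<bullet> h)" for y h
    have u'_axis: "u' y (axis b 1) = (y $ a * (bump_grad y $ b)) * G y + (y $ a * bump y) * (G' y $ b)" for y

    proof -
      have "axis b (1::real) $ a = 0" using ab by (simp add: axis_def)
      then show ?thesis by (simp add: u'_def inner_axis)
    qed
    have cont': "continuous_on UNIV (\<lambda>y. u' y (axis b 1))"
      unfolding u'_axis using R
      by (intro continuous_on_add continuous_on_cutoff_mult[where R=R] Gc continuous_intros cont) auto
    have "integral (cbox (-One) One) (\<lambda>y. u' y (axis b 1)) = 0"
    proof (rule integral_directional_derivative_eq_0[where u="\<lambda>y. y $ a * bump y * G y"])
      fix y :: "real^4"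
      show "((\<lambda>y. y $ a * bump y * G y) has_derivative u' y) (at y)"
      proof (cases "norm y < R")
        case True
        show ?thesis
          using has_derivative_mult[OF has_derivative_mult[OF bounded_linear_imp_has_derivative[OF
                bounded_linear_vec_nth[of a]] bump_has_derivative[of y]] der[OF True]]
          by (rule has_derivative_eq_rhs) (simp add: u'_def fun_eq_iff algebra_simps)
      next
        case False
        then have y: "y \<in> - cball 0 1" using R by auto
        have "u' y = (\<lambda>h. 0)" using False R by (auto simp: u'_def)
        then show ?thesis
          by (auto intro!: has_derivative_transform_within_open[OF has_derivative_const _ y])
      qed
    next
      show "continuous_on UNIV (\<lambda>y. u' y (axis b 1))" by (rule cont')
    qed (auto simp: u'_def)
    moreover have "(\<lambda>y. u' y (axis b 1)) integrable_on cbox (-One) One"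
      by (intro integrable_continuous continuous_on_subset[OF cont']) auto
    ultimately show ?thesis unfolding u'_axis by (simp add: has_integral_integrable_integral)
  qed
  have "((\<lambda>y. ((y $ i * (bump_grad y $ j)) * G y + (y $ i * bump y) * (G' y $ j))
     - ((y $ j * (bump_grad y $ i)) * G y + (y $ j * bump y) * (G' y $ i))) has_integral 0 - 0)
      (cbox (-One) One)"
    using ij by (intro has_integral_diff main) auto
  then show ?thesis
    by (rule has_integral_eq_rhs[OF has_integral_eq[rotated]]) (auto simp: bump_grad_def algebra_simps)
qed

section \<open>Gradients and the four coordinates\<close>

definition grad :: "(real^4 \<Rightarrow> real) \<Rightarrow> real^4 \<Rightarrow> real^4" where
  "grad u x = (\<chi> i. pd i u x)"

lemma grad_nth [simp]: "grad u x $ i = pd i u x"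
  by (simp add: grad_def)

lemma has_derivative_grad:
  assumes "u differentiable (at x)"
  shows "(u has_derivative (\<lambda>h. grad u x \<bullet> h)) (at x)"
proof -
  have d: "(u has_derivative frechet_derivative u (at x)) (at x)"
    using assms by (simp add: frechet_derivative_works)
  interpret linear "frechet_derivative u (at x)" by (rule has_derivative_linear[OF d])
  have "frechet_derivative u (at x) h = grad u x \<bullet> h" for h
  proof -
    have "frechet_derivative u (at x) h = frechet_derivative u (at x) (\<Sum>i\<in>UNIV. h $ i *\<^sub>R axis i 1)"
      using basis_expansion[of h] by (simp add: scalar_mult_eq_scaleR)
    also have "\<dots> = (\<Sum>i\<in>UNIV. h $ i * pd i u x)"
      by (simp add: sum scale pd_def)
    also have "\<dots> = grad u x \<bullet> h" by (simp add: inner_vec_def mult.commute)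
    finally show ?thesis .
  qed
  then have "frechet_derivative u (at x) = (\<lambda>h. grad u x \<bullet> h)" by auto
  then show ?thesis using d by simp
qed

lemma pd_eq_of_has_derivative:
  assumes "(u has_derivative (\<lambda>h. v \<bullet> h)) (at x)"
  shows "pd i u x = v $ i"
  using frechet_derivative_at[OF assms] unfolding pd_def by (metis inner_axis inner_real_def mult.right_neutral)

lemma C1_on_iff_grad:
  "C1_on S u \<longleftrightarrow> (\<forall>x\<in>S. (u has_derivative (\<lambda>h. grad u x \<bullet> h)) (at x)) \<and> continuous_on S (grad u)"
proof -
  have "continuous_on S (grad u) \<longleftrightarrow> (\<forall>i. continuous_on S (pd i u))"
  proof
    assume "continuous_on S (grad u)"
    then have "continuous_on S (\<lambda>x. grad u x $ i)" for i by (rule continuous_on_component)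
    then show "\<forall>i. continuous_on S (pd i u)" by (simp cong: continuous_on_cong)
  next
    assume "\<forall>i. continuous_on S (pd i u)"
    then show "continuous_on S (grad u)"
      unfolding grad_def[abs_def] by (intro continuous_on_vec_lambda) simp
  qed
  then show ?thesis
    unfolding C1_on_def using has_derivative_grad differentiableI by blast
qed

lemma C1_onI:
  assumes "\<And>x. x \<in> S \<Longrightarrow> (u has_derivative (\<lambda>h. v x \<bullet> h)) (at x)" "continuous_on S v"
  shows "C1_on S u"
proof -
  have "grad u x = v x" if "x \<in> S" for x
    using pd_eq_of_has_derivative[OF assms(1)[OF that]] by (simp add: vec_eq_iff)
  then show ?thesis using assms by (simp add: C1_on_iff_grad cong: continuous_on_cong)
qed

lemma UNIV_4_0: "(UNIV :: 4 set) = {0, 1, 2, 3}"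
proof -
  have "{0, 1, 2, 3} = (UNIV :: 4 set)"
    by (rule card_subset_eq) auto
  then show ?thesis ..
qed

lemma all_4_iff: "(\<forall>k::4. P k) \<longleftrightarrow> P 0 \<and> P 1 \<and> P 2 \<and> P 3"
proof -
  have "(\<forall>k::4. P k) \<longleftrightarrow> (\<forall>k\<in>UNIV. P k)" by simp
  then show ?thesis unfolding UNIV_4_0 by simp
qed

lemma sum_UNIV_4: "sum f (UNIV :: 4 set) = f 0 + f 1 + f 2 + f 3"
  unfolding UNIV_4_0 by (simp add: add_ac)

section \<open>The mean value property of the real component\<close>

text \<open>
  Real part of the product of the conjugate of \<open>y\<^sub>0 + y\<^sub>1 i - y\<^sub>2 j + y\<^sub>3 k\<close> with \<open>D g = 0\<close>. The diagonal
  terms of the product give the radial derivative of \<open>g\<close>; the off-diagonal ones pair up to rotations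
  because distinct quaternion units satisfy \<open>e\<^sub>i\<^sup>* e\<^sub>j = - e\<^sub>j\<^sup>* e\<^sub>i\<close>.
\<close>

lemma cimmino_radial_derivative:
  fixes y :: "real^4"
  assumes sys: "cimmino_system 0 \<Omega> g" and x: "x \<in> \<Omega>"
  defines "R l i j \<equiv> y $ i * grad (g l) x $ j - y $ j * grad (g l) x $ i"
  shows "grad (g 0) x \<bullet> y = R 1 0 1 + R 1 2 3 - R 2 0 2 + R 2 1 3 + R 3 0 3 + R 3 1 2"
proof -
  have E0: "pd 0 (g 0) x = pd 1 (g 1) x + pd 3 (g 3) x - pd 2 (g 2) x"
    and E1: "pd 1 (g 0) x = pd 3 (g 2) x + pd 2 (g 3) x - pd 0 (g 1) x"
    and E2: "pd 2 (g 0) x = pd 3 (g 1) x + pd 0 (g 2) x - pd 1 (g 3) x"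
    and E3: "pd 3 (g 0) x = - pd 2 (g 1) x - pd 1 (g 2) x - pd 0 (g 3) x"
    using sys x by (auto simp: cimmino_system_def algebra_simps)
  have "grad (g 0) x \<bullet> y = pd 0 (g 0) x * y $ 0 + pd 1 (g 0) x * y $ 1 + pd 2 (g 0) x * y $ 2 + pd 3 (g 0) x * y $ 3"
    by (simp add: inner_vec_def sum_UNIV_4)
  then show ?thesis unfolding E0 E1 E2 E3 R_def by (simp add: algebra_simps)
qed

text \<open>
  The factor \<open>4\<close> is the crude bound \<open>norm y \<le> \<Sum>\<^sub>i |y\<^sub>i|\<close> on the cube. Integrals over cubes instead of balls
  give access to the rule for differentiation under the integral sign.
\<close>

lemma scaled_cube_subset:
  fixes x y :: "real^4"
  assumes "cball x (4 * r) \<subseteq> \<Omega>" "y \<in> cbox (- One) One" "0 \<le> t" "t \<le> r"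
  shows "x + t *\<^sub>R y \<in> \<Omega>"
proof -
  have "norm y \<le> 4" using norm_le_cube[of y 1] assms(2) by simp
  then have "t * norm y \<le> r * 4" using assms(3,4) by (intro mult_mono) auto
  then have "x + t *\<^sub>R y \<in> cball x (4 * r)" using assms(3) by (simp add: dist_norm)
  then show ?thesis using assms(1) by blast
qed

text \<open>
  The integral with \<open>r\<close> replaced by \<open>t\<close> has derivative zero on \<open>0 < t < r\<close>, since the radial
  derivative is a sum of rotations; its value at \<open>t = 0\<close> is the right-hand side.
\<close>

lemma mean_value_0:
  assumes C1: "\<And>k. C1_on \<Omega> (g k)" and sys: "cimmino_system 0 \<Omega> g"
    and ball: "cball x (4 * r) \<subseteq> \<Omega>" and r: "r > 0"
  shows "integral (cbox (-One) One) (\<lambda>y. bump y * g 0 (x + r *\<^sub>R y)) =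
    integral (cbox (-One) One) bump * g 0 x"
proof -
  let ?Q = "cbox (-One) One :: (real^4) set"
  have der: "(g k has_derivative (\<lambda>h. grad (g k) z \<bullet> h)) (at z)" if "z \<in> \<Omega>" for k z
    using C1[of k] that by (simp add: C1_on_iff_grad)
  have gc: "continuous_on \<Omega> (g k)" for k
    by (intro continuous_at_imp_continuous_on ballI has_derivative_continuous[OF der])
  have gradc: "continuous_on \<Omega> (grad (g k))" for k
    using C1[of k] by (simp add: C1_on_iff_grad)
  define H where "H t = integral ?Q (\<lambda>y. bump y * g 0 (x + t *\<^sub>R y))" for t
  have H': "(H has_field_derivative integral ?Q (\<lambda>y. bump y * (grad (g 0) (x + t *\<^sub>R y) \<bullet> y))) (at t within {0..r})"
    if t: "t \<in> {0..r}" for t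
    unfolding H_def
  proof (rule leibniz_rule_field_derivative)
    fix s and y :: "real^4" assume s: "s \<in> {0..r}" and y: "y \<in> ?Q"
    have \<Omega>: "x + s *\<^sub>R y \<in> \<Omega>" using scaled_cube_subset[OF ball y] s by auto
    have "((\<lambda>s. g 0 (x + s *\<^sub>R y)) has_derivative (\<lambda>h. grad (g 0) (x + s *\<^sub>R y) \<bullet> (h *\<^sub>R y))) (at s within {0..r})"
      by (rule has_derivative_compose[where f="\<lambda>s. x + s *\<^sub>R y" and g="g 0", OF _ der[OF \<Omega>]]) (auto intro!: derivative_eq_intros)
    then have "((\<lambda>s. g 0 (x + s *\<^sub>R y)) has_field_derivative grad (g 0) (x + s *\<^sub>R y) \<bullet> y) (at s within {0..r})"
      by (rule has_derivative_imp_has_field_derivative) simp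
    then show "((\<lambda>s. bump y * g 0 (x + s *\<^sub>R y)) has_field_derivative bump y * (grad (g 0) (x + s *\<^sub>R y) \<bullet> y)) (at s within {0..r})"
      by (rule DERIV_cmult)
  next
    fix s assume s: "s \<in> {0..r}"
    show "(\<lambda>y. bump y * g 0 (x + s *\<^sub>R y)) integrable_on ?Q"
      using scaled_cube_subset[OF ball] s
      by (intro integrable_continuous continuous_on_compose2[OF gc] continuous_intros) auto
  next
    show "continuous_on ({0..r} \<times> ?Q) (\<lambda>(s, y). bump y * (grad (g 0) (x + s *\<^sub>R y) \<bullet> y))"
      using scaled_cube_subset[OF ball] unfolding split_beta
      by (intro continuous_on_compose2[OF gradc] continuous_intros) auto
  qed (use t in auto)
  \<comment> \<open>The chain rule turns the gradient of \<open>g (x + t y)\<close> into \<open>t\<close> times that of \<open>g\<close>, whence \<open>t > 0\<close>.\<close>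
  have H'_0: "integral ?Q (\<lambda>y. bump y * (grad (g 0) (x + t *\<^sub>R y) \<bullet> y)) = 0" if t: "t \<in> {0<..r}" for t
  proof -
    define R where "R l i j y = bump y * (y $ i * grad (g l) (x + t *\<^sub>R y) $ j - y $ j * grad (g l) (x + t *\<^sub>R y) $ i)"
      for l i j y
    have R0: "(R l i j has_integral 0) ?Q" if ij: "i \<noteq> j" for l i j
    proof -
      have \<Omega>: "x + t *\<^sub>R y \<in> \<Omega>" if "norm y < 4" for y
      proof -
        have "t * norm y \<le> r * 4" using that t by (intro mult_mono) auto
        then have "x + t *\<^sub>R y \<in> cball x (4 * r)" using t by (simp add: dist_norm)
        then show ?thesis using ball by blast
      qed
      have "((\<lambda>y. bump y * (y $ i * (t *\<^sub>R grad (g l) (x + t *\<^sub>R y)) $ j - y $ j * (t *\<^sub>R grad (g l) (x + t *\<^sub>R y)) $ i)) has_integral 0) ?Q"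
      proof (rule integral_bump_rotation_eq_0[where R=4 and G="\<lambda>y. g l (x + t *\<^sub>R y)"])
        fix y :: "real^4" assume y: "norm y < 4"
        have "((\<lambda>y. g l (x + t *\<^sub>R y)) has_derivative (\<lambda>h. grad (g l) (x + t *\<^sub>R y) \<bullet> (t *\<^sub>R h))) (at y)"
          by (rule has_derivative_compose[where f="\<lambda>y. x + t *\<^sub>R y" and g="g l", OF _ der[OF \<Omega>[OF y]]]) (auto intro!: derivative_eq_intros)
        then show "((\<lambda>y. g l (x + t *\<^sub>R y)) has_derivative (\<lambda>h. (t *\<^sub>R grad (g l) (x + t *\<^sub>R y)) \<bullet> h)) (at y)"
          by simp
      next
        show "continuous_on (ball 0 4) (\<lambda>y. t *\<^sub>R grad (g l) (x + t *\<^sub>R y))"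
          using \<Omega> by (intro continuous_on_compose2[OF gradc] continuous_intros) auto
      qed (use ij in auto)
      from has_integral_mult_right[OF this, of "inverse t"] show ?thesis
        by (rule has_integral_eq_rhs[OF has_integral_eq[rotated]]) (use t in \<open>auto simp: R_def field_simps\<close>)
    qed
    have sum0: "((\<lambda>y. R 1 0 1 y + R 1 2 3 y - R 2 0 2 y + R 2 1 3 y + R 3 0 3 y + R 3 1 2 y) has_integral 0 + 0 - 0 + 0 + 0 + 0) ?Q"
      by (intro has_integral_add has_integral_diff R0) auto
    have radial: "R 1 0 1 y + R 1 2 3 y - R 2 0 2 y + R 2 1 3 y + R 3 0 3 y + R 3 1 2 y =
        bump y * (grad (g 0) (x + t *\<^sub>R y) \<bullet> y)" if "y \<in> ?Q" for y
    proof -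
      have "x + t *\<^sub>R y \<in> \<Omega>" using scaled_cube_subset[OF ball that] t by auto
      note eq = cimmino_radial_derivative[OF sys this, of y]
      show ?thesis unfolding eq R_def by (simp only: distrib_left right_diff_distrib)
    qed
    have "((\<lambda>y. bump y * (grad (g 0) (x + t *\<^sub>R y) \<bullet> y)) has_integral 0 + 0 - 0 + 0 + 0 + 0) ?Q"
      by (rule has_integral_eq[OF radial sum0])
    then show ?thesis by (simp add: integral_unique)
  qed
  have "H r = H 0"
  proof (rule DERIV_isconst2[where x=r and a=0 and b=r])
    show "continuous_on {0..r} H"
      by (rule DERIV_continuous_on[OF H'])
    show "(H has_field_derivative 0) (at t)" if "0 < t" "t < r" for t
    proof -
      have "(H has_field_derivative 0) (at t within {0..r})"
        using H'[of t] H'_0[of t] that by simp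
      then show ?thesis using at_within_Icc_at[of 0 t r] that by simp
    qed
  qed (use r in auto)
  then show ?thesis by (simp add: H_def)
qed

section \<open>Right multiplication by quaternion units\<close>

text \<open>
  The products \<open>f i\<close>, \<open>f j\<close> and \<open>f k\<close>. They commute with operators acting from the left, and up to sign
  their real parts are the other three components of \<open>f\<close>. A statement about all
  components of all solutions therefore reduces to component \<open>0\<close>.
\<close>

definition rmul_i :: "(4 \<Rightarrow> real^4 \<Rightarrow> real) \<Rightarrow> 4 \<Rightarrow> real^4 \<Rightarrow> real" where
  "rmul_i f = tuple4 (\<lambda>x. - f 1 x) (f 0) (f 3) (\<lambda>x. - f 2 x)"

definition rmul_j :: "(4 \<Rightarrow> real^4 \<Rightarrow> real) \<Rightarrow> 4 \<Rightarrow> real^4 \<Rightarrow> real" where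
  "rmul_j f = tuple4 (\<lambda>x. - f 2 x) (\<lambda>x. - f 3 x) (f 0) (f 1)"

definition rmul_k :: "(4 \<Rightarrow> real^4 \<Rightarrow> real) \<Rightarrow> 4 \<Rightarrow> real^4 \<Rightarrow> real" where
  "rmul_k f = tuple4 (\<lambda>x. - f 3 x) (f 2) (\<lambda>x. - f 1 x) (f 0)"

lemmas rmul_defs = rmul_i_def rmul_j_def rmul_k_def

lemma C1_on_uminus:
  assumes "C1_on S u" shows "C1_on S (\<lambda>x. - u x)"
proof (rule C1_onI)
  show "((\<lambda>x. - u x) has_derivative (\<lambda>h. (- grad u x) \<bullet> h)) (at x)" if "x \<in> S" for x
    using assms that by (auto simp: C1_on_iff_grad intro!: derivative_eq_intros)
  show "continuous_on S (\<lambda>x. - grad u x)"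
    using assms by (auto simp: C1_on_iff_grad intro!: continuous_intros)
qed

lemma pd_uminus:
  assumes "u differentiable (at x)" shows "pd i (\<lambda>x. - u x) x = - pd i u x"
proof -
  have "((\<lambda>x. - u x) has_derivative (\<lambda>h. (- grad u x) \<bullet> h)) (at x)"
    using has_derivative_grad[OF assms] by (auto intro!: derivative_eq_intros)
  from pd_eq_of_has_derivative[OF this] show ?thesis by simp
qed

lemma C1_on_rmul:
  assumes "\<And>k. C1_on S (f k)"
  shows "C1_on S (rmul_i f k)" "C1_on S (rmul_j f k)" "C1_on S (rmul_k f k)"
  using assms by (auto simp: rmul_defs tuple4_def C1_on_uminus)

lemma cimmino_system_rmul:
  assumes "\<And>k. C1_on \<Omega> (f k)" "cimmino_system q \<Omega> f"
  shows "cimmino_system q \<Omega> (rmul_i f)" "cimmino_system q \<Omega> (rmul_j f)" "cimmino_system q \<Omega> (rmul_k f)"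
proof -
  have d: "f k differentiable (at x)" if "x \<in> \<Omega>" for k x
    using assms(1) that by (auto simp: C1_on_def)
  show "cimmino_system q \<Omega> (rmul_i f)" "cimmino_system q \<Omega> (rmul_j f)" "cimmino_system q \<Omega> (rmul_k f)"
    using assms(2) by (auto simp: cimmino_system_def rmul_defs pd_uminus d algebra_simps)
qed

section \<open>The mean value property of solutions\<close>

lemma mean_value:
  assumes C1: "\<And>k. C1_on \<Omega> (g k)" and sys: "cimmino_system 0 \<Omega> g"
    and ball: "cball x (4 * r) \<subseteq> \<Omega>" and r: "r > 0"
  shows "integral (cbox (-One) One) (\<lambda>y. bump y * g k (x + r *\<^sub>R y)) =
    integral (cbox (-One) One) bump * g k x"
proof -
  note mv = mean_value_0[OF _ _ ball r]
  show ?thesis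
    using mv[OF C1 sys] mv[OF C1_on_rmul(1)[OF C1] cimmino_system_rmul(1)[OF C1 sys]]
      mv[OF C1_on_rmul(2)[OF C1] cimmino_system_rmul(2)[OF C1 sys]]
      mv[OF C1_on_rmul(3)[OF C1] cimmino_system_rmul(3)[OF C1 sys]]
      all_4_iff[of "\<lambda>k. integral (cbox (-One) One) (\<lambda>y. bump y * g k (x + r *\<^sub>R y)) =
    integral (cbox (-One) One) bump * g k x"]
    by (simp add: rmul_defs)
qed

lemma integral_bump_pos: "0 < integral (cbox (-One) One) bump"
proof -
  let ?Q = "cbox (-One) One :: (real^4) set"
  have c: "continuous_on ?Q bump" using continuous_on_bump[OF continuous_on_id] by simp
  have i: "bump integrable_on ?Q" by (rule integrable_continuous[OF c])
  have "0 \<le> integral ?Q bump" by (intro integral_nonneg[OF i] bump_nonneg)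
  moreover have "integral ?Q bump \<noteq> 0"
  proof
    assume "integral ?Q bump = 0"
    then have "(bump has_integral 0) ?Q" using i by (metis integrable_integral)
    then have "bump 0 = 0"
      by (rule has_integral_0_cbox_imp_0[OF c bump_nonneg]) (auto simp: box_ne_empty mem_box)
    then show False by (simp add: bump_0)
  qed
  ultimately show ?thesis by simp
qed

text \<open>
  Since \<open>\<partial>\<^sub>i (exp (- q \<bullet> y) f) = exp (- q \<bullet> y) (\<partial>\<^sub>i f - q\<^sub>i f)\<close>, the factor \<open>exp (- q \<bullet> y)\<close> reduces the system to
  \<open>q = 0\<close>. The constant \<open>exp (- q \<bullet> x)\<close> then divides out, so that the remaining weight depends only on
  the displacement.
\<close>

lemma weighted_mean_value:
  assumes C1: "\<And>k. C1_on \<Omega> (f k)" and sys: "cimmino_system q \<Omega> f"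
    and ball: "cball x (4 * r) \<subseteq> \<Omega>" and r: "r > 0"
  shows "integral (cbox (-One) One) (\<lambda>y. bump y * (exp (- (q \<bullet> (r *\<^sub>R y))) * f k (x + r *\<^sub>R y))) =
    integral (cbox (-One) One) bump * f k x"
proof -
  let ?e = "\<lambda>y. exp (- (q \<bullet> y))"
  define g where "g k y = ?e y * f k y" for k y
  have der: "(g k has_derivative (\<lambda>h. (?e y *\<^sub>R (grad (f k) y - f k y *\<^sub>R q)) \<bullet> h)) (at y)" if "y \<in> \<Omega>" for k y
  proof -
    have f: "(f k has_derivative (\<lambda>h. grad (f k) y \<bullet> h)) (at y)"
      using C1[of k] that by (simp add: C1_on_iff_grad)
    have e: "(?e has_derivative (\<lambda>h. - ?e y * (q \<bullet> h))) (at y)"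
      by (auto intro!: derivative_eq_intros)
    show ?thesis
      unfolding g_def using has_derivative_mult[OF e f]
      by (rule has_derivative_eq_rhs) (simp add: fun_eq_iff inner_simps algebra_simps)
  qed
  have fc: "continuous_on \<Omega> (f k)" "continuous_on \<Omega> (grad (f k))" for k
    using C1[of k] by (auto simp: C1_on_iff_grad intro!: continuous_at_imp_continuous_on has_derivative_continuous)
  have C1g: "C1_on \<Omega> (g k)" for k
    by (rule C1_onI[OF der]) (auto intro!: continuous_intros fc)
  have pdg: "pd i (g k) y = ?e y * (pd i (f k) y - f k y * q $ i)" if "y \<in> \<Omega>" for i k y
    using pd_eq_of_has_derivative[OF der[OF that]] by simp
  have "cimmino_system 0 \<Omega> g"
    unfolding cimmino_system_def
  proof
    fix y assume y: "y \<in> \<Omega>"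
    note s = sys[unfolded cimmino_system_def, rule_format, OF y]
    \<comment> \<open>Solved for the derivatives of \<open>f 0\<close>, the equations become rewrite rules that settle the goal by ring identities.\<close>
    have E: "pd 0 (f 0) y = q$0 * f 0 y + q$2 * f 2 y - q$1 * f 1 y - q$3 * f 3 y
        - pd 2 (f 2) y + pd 1 (f 1) y + pd 3 (f 3) y"
      "pd 1 (f 0) y = q$1 * f 0 y + q$0 * f 1 y - q$3 * f 2 y - q$2 * f 3 y
        - pd 0 (f 1) y + pd 3 (f 2) y + pd 2 (f 3) y"
      "pd 2 (f 0) y = q$2 * f 0 y + q$1 * f 3 y - q$3 * f 1 y - q$0 * f 2 y
        - pd 1 (f 3) y + pd 3 (f 1) y + pd 0 (f 2) y"
      "pd 3 (f 0) y = q$3 * f 0 y + q$2 * f 1 y + q$1 * f 2 y + q$0 * f 3 y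
        - pd 2 (f 1) y - pd 1 (f 2) y - pd 0 (f 3) y"
      using s by linarith+
    show "pd 0 (g 0) y + pd 2 (g 2) y - pd 1 (g 1) y - pd 3 (g 3) y
       = (0::real^4)$0 * g 0 y + (0::real^4)$2 * g 2 y - (0::real^4)$1 * g 1 y - (0::real^4)$3 * g 3 y \<and>
     pd 1 (g 0) y + pd 0 (g 1) y - pd 3 (g 2) y - pd 2 (g 3) y
       = (0::real^4)$1 * g 0 y + (0::real^4)$0 * g 1 y - (0::real^4)$3 * g 2 y - (0::real^4)$2 * g 3 y \<and>
     pd 2 (g 0) y + pd 1 (g 3) y - pd 3 (g 1) y - pd 0 (g 2) y
       = (0::real^4)$2 * g 0 y + (0::real^4)$1 * g 3 y - (0::real^4)$3 * g 1 y - (0::real^4)$0 * g 2 y \<and>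
     pd 3 (g 0) y + pd 2 (g 1) y + pd 1 (g 2) y + pd 0 (g 3) y
       = (0::real^4)$3 * g 0 y + (0::real^4)$2 * g 1 y + (0::real^4)$1 * g 2 y + (0::real^4)$0 * g 3 y"
      unfolding pdg[OF y] E by (simp add: algebra_simps)
  qed
  from mean_value[OF C1g this ball r, of k]
  have "integral (cbox (-One) One) (\<lambda>y. bump y * g k (x + r *\<^sub>R y)) = integral (cbox (-One) One) bump * g k x" .
  moreover have "(\<lambda>y. bump y * g k (x + r *\<^sub>R y)) =
      (\<lambda>y. ?e x * (bump y * (?e (r *\<^sub>R y) * f k (x + r *\<^sub>R y))))"
    by (auto simp: g_def inner_simps exp_add[symmetric] fun_eq_iff simp flip: mult.assoc)
  ultimately have "?e x * integral (cbox (-One) One) (\<lambda>y. bump y * (?e (r *\<^sub>R y) * f k (x + r *\<^sub>R y))) =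
      ?e x * (integral (cbox (-One) One) bump * f k x)"
    by (simp add: g_def)
  then show ?thesis by simp
qed

section \<open>The local reproducing kernel\<close>

lemma norm_scaled_ge_1:
  fixes z :: "'a::real_normed_vector"
  assumes "r > 0" "norm z \<ge> r"
  shows "norm (z /\<^sub>R r) \<ge> 1"
proof -
  have "norm (z /\<^sub>R r) = norm z / r" using assms by (simp add: divide_inverse mult.commute)
  then show ?thesis using assms by simp
qed

text \<open>
  The weight of the mean value formula after the substitution \<open>y \<mapsto> x + r y\<close>, normalised. For \<open>q \<noteq> 0\<close> it
  is adapted to the inhomogeneous system and does not have integral one.
\<close>

definition mollifier :: "real^4 \<Rightarrow> real \<Rightarrow> real^4 \<Rightarrow> real" where
  "mollifier q r z = bump (z /\<^sub>R r) * exp (- (q \<bullet> z)) / (r ^ 4 * integral (cbox (-One) One) bump)"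

lemma mollifier_reproduces:
  assumes \<Omega>: "open \<Omega>" and C1: "\<And>k. C1_on \<Omega> (f k)" and sys: "cimmino_system q \<Omega> f"
    and ball: "cball x (4 * r) \<subseteq> \<Omega>" and r: "r > 0"
  shows "(LINT y|lebesgue_on \<Omega>. mollifier q r (y - x) * f k y) = f k x"
proof -
  let ?c = "integral (cbox (-One) One) bump"
  let ?B = "cbox (x - r *\<^sub>R One) (x + r *\<^sub>R One)"
  define F where "F y = bump ((y - x) /\<^sub>R r) * (exp (- (q \<bullet> (y - x))) * f k y)" for y
  have B: "?B \<subseteq> \<Omega>"
  proof
    fix y assume "y \<in> ?B"
    then have "y - x \<in> cbox (- r *\<^sub>R One) (r *\<^sub>R One)" by (simp add: mem_box algebra_simps)
    then have "y \<in> cball x (4 * r)" using norm_le_cube by (force simp: dist_norm norm_minus_commute)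
    then show "y \<in> \<Omega>" using ball by blast
  qed
  have fc: "continuous_on \<Omega> (f k)"
    using C1[of k] by (auto simp: C1_on_iff_grad intro!: continuous_at_imp_continuous_on has_derivative_continuous)
  have Fc: "continuous_on ?B F"
    unfolding F_def by (intro continuous_intros continuous_on_subset[OF fc B])
  have out: "F y = 0" if "y \<notin> ?B" for y
  proof -
    have "y - x \<notin> cball 0 r"
      using that cball_subset_cube[of r] by (auto simp: mem_box algebra_simps subset_iff)
    then have "norm ((y - x) /\<^sub>R r) \<ge> 1" using r by (intro norm_scaled_ge_1) auto
    then show ?thesis by (simp add: F_def)
  qed
  have "((\<lambda>y. F (r *\<^sub>R y + x)) has_integral (integral ?B F /\<^sub>R r ^ DIM(real^4)))
      (cbox ((x - r *\<^sub>R One - x) /\<^sub>R r) ((x + r *\<^sub>R One - x) /\<^sub>R r))"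
    using has_integral_affinity_iff[OF r, of F x "integral ?B F" "x - r *\<^sub>R One" "x + r *\<^sub>R One"]
      integrable_integral[OF integrable_continuous[OF Fc]] by simp
  then have "((\<lambda>y. F (r *\<^sub>R y + x)) has_integral (integral ?B F / r ^ 4)) (cbox (-One) One)"
    using r by (simp add: divide_inverse mult.commute)
  from integral_unique[OF this]
  have "integral (cbox (-One) One) (\<lambda>y. bump y * (exp (- (q \<bullet> (r *\<^sub>R y))) * f k (x + r *\<^sub>R y))) = integral ?B F / r ^ 4"
    using r by (simp add: F_def add.commute)
  then have "integral ?B F / r ^ 4 = ?c * f k x"
    unfolding weighted_mean_value[OF C1 sys ball r, of k] by (rule sym)
  then have int_B: "integral ?B F = r ^ 4 * ?c * f k x" using r by (simp add: field_simps)
  have "(LINT y|lebesgue_on \<Omega>. F y) = (LINT y|lebesgue_on \<Omega>. (if y \<in> ?B then F y else 0))"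
    by (rule Bochner_Integration.integral_cong) (auto simp: out)
  also have "\<dots> = (LINT y|lebesgue_on ?B. F y)"
    using \<Omega> by (intro Lebesgue_Measure.integral_restrict B) (auto intro: borel_open)
  also have "\<dots> = integral ?B F"
    by (intro lebesgue_integral_eq_integral absolutely_integrable_imp_integrable
        absolutely_integrable_continuous Fc) auto
  finally have "(LINT y|lebesgue_on \<Omega>. F y) = r ^ 4 * ?c * f k x" using int_B by simp
  moreover have "mollifier q r (y - x) * f k y = F y / (r ^ 4 * ?c)" for y
    by (simp add: mollifier_def F_def)
  ultimately show ?thesis using r integral_bump_pos by simp
qed

definition mollifier_grad :: "real^4 \<Rightarrow> real \<Rightarrow> real^4 \<Rightarrow> real^4" where
  "mollifier_grad q r z = (exp (- (q \<bullet> z)) / (r ^ 4 * integral (cbox (-One) One) bump)) *\<^sub>R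
     ((1 / r) *\<^sub>R bump_grad (z /\<^sub>R r) - bump (z /\<^sub>R r) *\<^sub>R q)"

lemma mollifier_has_derivative:
  assumes "r > 0"
  shows "(mollifier q r has_derivative (\<lambda>h. mollifier_grad q r z \<bullet> h)) (at z)"
proof -
  let ?C = "r ^ 4 * integral (cbox (-One) One) bump"
  have b: "((\<lambda>z. bump (z /\<^sub>R r)) has_derivative (\<lambda>h. bump_grad (z /\<^sub>R r) \<bullet> (h /\<^sub>R r))) (at z)"
    by (rule has_derivative_compose[where f="\<lambda>z. z /\<^sub>R r" and g=bump, OF _ bump_has_derivative])
       (auto intro!: derivative_eq_intros)
  have e: "((\<lambda>z. exp (- (q \<bullet> z)) / ?C) has_derivative (\<lambda>h. - (exp (- (q \<bullet> z)) / ?C) * (q \<bullet> h))) (at z)"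
    by (auto intro!: derivative_eq_intros simp: divide_inverse)
  show ?thesis
    unfolding mollifier_def[abs_def] times_divide_eq_right[symmetric]
    by (rule has_derivative_eq_rhs[OF has_derivative_mult[OF b e]])
       (simp add: fun_eq_iff mollifier_grad_def inner_simps divide_inverse algebra_simps)
qed

lemma continuous_mollifier_grad: "continuous_on UNIV (mollifier_grad q r)"
  unfolding mollifier_grad_def[abs_def] divide_inverse by (intro continuous_intros)

lemma mollifier_support:
  assumes "r > 0" "norm z > r"
  shows "mollifier q r z = 0" "mollifier_grad q r z = 0"
proof -
  have "norm (z /\<^sub>R r) \<ge> 1" using assms by (intro norm_scaled_ge_1) auto
  then show "mollifier q r z = 0" "mollifier_grad q r z = 0"
    by (simp_all add: mollifier_def mollifier_grad_def)
qed

section \<open>Square-integrable functions\<close>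

lemma square_integrable_mult:
  assumes "square_integrable_on S u" "square_integrable_on S v"
  shows "integrable (lebesgue_on S) (\<lambda>x. u x * v x)"
proof (rule Bochner_Integration.integrable_bound)
  show "integrable (lebesgue_on S) (\<lambda>x. (u x)\<^sup>2 + (v x)\<^sup>2)"
    using assms by (auto simp: square_integrable_on_def)
  show "(\<lambda>x. u x * v x) \<in> borel_measurable (lebesgue_on S)"
    using assms by (auto simp: square_integrable_on_def)
  have "\<bar>a * b\<bar> \<le> a\<^sup>2 + b\<^sup>2" for a b :: real
    using sum_squares_bound[of "\<bar>a\<bar>" "\<bar>b\<bar>"] mult_nonneg_nonneg[of "\<bar>a\<bar>" "\<bar>b\<bar>"]
    unfolding abs_mult power2_abs by linarith
  then show "AE x in lebesgue_on S. norm (u x * v x) \<le> norm ((u x)\<^sup>2 + (v x)\<^sup>2)"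
    by (intro AE_I2) simp
qed

lemma square_integrable_0 [simp]: "square_integrable_on S (\<lambda>x. 0)"
  by (simp add: square_integrable_on_def)

lemma square_integrable_cmult:
  assumes "square_integrable_on S u" shows "square_integrable_on S (\<lambda>x. c * u x)"
  using assms by (auto simp: square_integrable_on_def power_mult_distrib)

lemma square_integrable_uminus:
  assumes "square_integrable_on S u" shows "square_integrable_on S (\<lambda>x. - u x)"
  using square_integrable_cmult[OF assms, of "-1"] by simp

lemma square_integrable_add:
  assumes "square_integrable_on S u" "square_integrable_on S v"
  shows "square_integrable_on S (\<lambda>x. u x + v x)"
proof -
  have "integrable (lebesgue_on S) (\<lambda>x. (u x)\<^sup>2 + (v x)\<^sup>2 + 2 * (u x * v x))"
    using assms square_integrable_mult[OF assms] by (auto simp: square_integrable_on_def)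
  then have "integrable (lebesgue_on S) (\<lambda>x. (u x + v x)\<^sup>2)"
    by (simp add: power2_sum mult.assoc)
  then show ?thesis using assms by (auto simp: square_integrable_on_def)
qed

lemma square_integrable_diff:
  assumes "square_integrable_on S u" "square_integrable_on S v"
  shows "square_integrable_on S (\<lambda>x. u x - v x)"
  using square_integrable_add[OF assms(1) square_integrable_uminus[OF assms(2)]] by simp

text \<open>
  Kernels of compact support become elements of the Hilbert space.
\<close>

lemma square_integrable_compact_support:
  assumes S: "S \<in> sets lebesgue" and c: "continuous_on UNIV \<phi>"
    and supp: "\<And>y. y \<notin> cball x R \<Longrightarrow> \<phi> y = 0"
  shows "square_integrable_on S \<phi>"
proof -
  have m: "\<phi> \<in> borel_measurable lebesgue"
    using c by (simp add: borel_measurable_continuous_onI measurable_completion)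
  have "bounded (\<phi> ` cball x R)"
    by (intro compact_imp_bounded compact_continuous_image continuous_on_subset[OF c]) auto
  then obtain B where B: "\<And>y. y \<in> cball x R \<Longrightarrow> \<bar>\<phi> y\<bar> \<le> B"
    unfolding bounded_iff by (metis imageI real_norm_def)
  have "integrable lebesgue (\<lambda>y. \<bar>\<phi> y\<bar>\<^sup>2)"
  proof (rule Bochner_Integration.integrable_bound)
    show "integrable lebesgue (\<lambda>y. B\<^sup>2 * indicator (cball x R) y :: real)"
      using emeasure_lborel_cball_finite[of x R] by (intro integrable_mult_right integrable_real_indicator) auto
    have "\<bar>\<phi> y\<bar>\<^sup>2 \<le> B\<^sup>2 * indicator (cball x R) y" for y
      using B[of y] supp[of y] power_mono[of "\<bar>\<phi> y\<bar>" B 2] by (cases "y \<in> cball x R") (auto simp del: mem_cball)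
    then show "AE y in lebesgue. norm (\<bar>\<phi> y\<bar>\<^sup>2) \<le> norm (B\<^sup>2 * indicator (cball x R) y :: real)"
      by (intro AE_I2) (simp add: order_trans[OF _ abs_ge_self])
  qed (use m in measurable)
  then have "integrable (lebesgue_on S) (\<lambda>y. \<bar>\<phi> y\<bar>\<^sup>2)"
    using S integrable_mult_indicator[of S lebesgue "\<lambda>y. \<bar>\<phi> y\<bar>\<^sup>2"]
    by (simp add: integrable_restrict_space)
  moreover have "\<phi> \<in> borel_measurable (lebesgue_on S)"
    using m by (rule measurable_restrict_space1)
  ultimately show ?thesis by (simp add: square_integrable_on_def)
qed

lemma square_integrable_indicator_cball:
  assumes S: "S \<in> sets lebesgue"
  shows "square_integrable_on S (indicator (cball x R))"
proof -
  have "integrable lebesgue (\<lambda>y. \<bar>indicator (cball x R) y :: real\<bar>\<^sup>2)"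
  proof -
    have "(\<lambda>y. \<bar>indicator (cball x R) y :: real\<bar>\<^sup>2) = indicator (cball x R)"
      by (auto simp: indicator_def)
    then show ?thesis using emeasure_lborel_cball_finite[of x R] by (auto intro!: integrable_real_indicator)
  qed
  then have "integrable (lebesgue_on S) (\<lambda>y. \<bar>indicator (cball x R) y :: real\<bar>\<^sup>2)"
    using S integrable_mult_indicator[of S lebesgue "\<lambda>y. \<bar>indicator (cball x R) y :: real\<bar>\<^sup>2"]
    by (simp add: integrable_restrict_space)
  moreover have "indicator (cball x R) \<in> borel_measurable (lebesgue_on S)"
    by (rule measurable_restrict_space1) (auto intro!: borel_measurable_indicator)
  ultimately show ?thesis by (simp add: square_integrable_on_def)
qed

section \<open>Convolution with a compactly supported kernel\<close>

lemma compact_support_uniformly_continuous: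
  fixes f :: "real^4 \<Rightarrow> 'b::metric_space"
  assumes c: "continuous_on UNIV f" and supp: "\<And>z. norm z > r \<Longrightarrow> f z = b" and e: "e > 0"
  obtains d where "d > 0" "d \<le> 1" "\<And>z z'. dist z' z < d \<Longrightarrow> dist (f z') (f z) < e"
proof -
  have "uniformly_continuous_on (cball 0 (r + 1)) f"
    by (intro compact_uniformly_continuous continuous_on_subset[OF c]) auto
  then obtain d where d: "d > 0"
    "\<And>z z'. \<lbrakk>z \<in> cball 0 (r + 1); z' \<in> cball 0 (r + 1); dist z' z < d\<rbrakk> \<Longrightarrow> dist (f z') (f z) < e"
    using e unfolding uniformly_continuous_on_def by metis
  show ?thesis
  proof (rule that[of "min d 1"])
    fix z z' :: "real^4" assume z: "dist z' z < min d 1"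
    show "dist (f z') (f z) < e"
    proof (cases "z \<in> cball 0 (r + 1) \<and> z' \<in> cball 0 (r + 1)")
      case True then show ?thesis using d z by simp
    next
      case False
      moreover have "\<bar>norm z' - norm z\<bar> \<le> dist z' z" by (simp add: dist_norm norm_triangle_ineq3)
      ultimately have "norm z > r" "norm z' > r" using z by auto
      then show ?thesis using supp e by simp
    qed
  qed (use d in auto)
qed

text \<open>
  Smoothing by a compactly supported \<open>C\<^sup>1\<close> kernel. The difference quotient is controlled by
  the modulus of continuity of the gradient of the kernel, uniformly on a ball of radius \<open>r + 1\<close> around \<open>x\<close>,
  and outside that ball all kernels \<open>\<phi> (y - x')\<close> with \<open>|x' - x| < 1\<close> vanish. Thus only the integral of \<open>|u|\<close>
  over a ball enters, which exists for square-integrable \<open>u\<close>.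
\<close>

lemma convolution_C1:
  fixes \<phi> :: "real^4 \<Rightarrow> real" and \<phi>' :: "real^4 \<Rightarrow> real^4"
  assumes S: "S \<in> sets lebesgue" and u: "square_integrable_on S u"
    and der: "\<And>z. (\<phi> has_derivative (\<lambda>h. \<phi>' z \<bullet> h)) (at z)" and cont: "continuous_on UNIV \<phi>'"
    and supp: "\<And>z. norm z > r \<Longrightarrow> \<phi> z = 0" "\<And>z. norm z > r \<Longrightarrow> \<phi>' z = 0"
  defines "V \<equiv> \<lambda>x. \<chi> i. - (LINT y|lebesgue_on S. \<phi>' (y - x) $ i * u y)"
  shows "((\<lambda>x. LINT y|lebesgue_on S. \<phi> (y - x) * u y) has_derivative (\<lambda>h. V x \<bullet> h)) (at x)"
    and "continuous_on UNIV V"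
proof -
  let ?M = "lebesgue_on S"
  have \<phi>c: "continuous_on UNIV \<phi>"
    by (intro continuous_at_imp_continuous_on ballI has_derivative_continuous[OF der])
  have sq: "square_integrable_on S (\<lambda>y. \<phi> (y - x))" for x
    by (rule square_integrable_compact_support[OF S, of _ x r])
       (auto intro!: continuous_on_compose2[OF \<phi>c] continuous_intros supp simp: dist_norm norm_minus_commute)
  have sq': "square_integrable_on S (\<lambda>y. \<phi>' (y - x) $ i)" for x i
    by (rule square_integrable_compact_support[OF S, of _ x r])
       (auto intro!: continuous_on_compose2[OF cont] continuous_intros simp: supp dist_norm norm_minus_commute)
  note int = square_integrable_mult[OF sq u] and int' = square_integrable_mult[OF sq' u]
  have intB: "integrable ?M (\<lambda>y. indicator (cball x R) y * \<bar>u y\<bar>)" for x R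
  proof -
    have "integrable ?M (\<lambda>y. \<bar>indicator (cball x R) y * u y\<bar>)"
      by (intro integrable_abs square_integrable_mult square_integrable_indicator_cball S u)
    then show ?thesis by (simp add: abs_mult)
  qed
  have bound: "\<bar>LINT y|?M. k y * u y\<bar> \<le> e * (LINT y|?M. indicator (cball x (r + 1)) y * \<bar>u y\<bar>)"
    if "integrable ?M (\<lambda>y. k y * u y)" "\<And>y. \<bar>k y\<bar> \<le> e" "\<And>y. y \<notin> cball x (r + 1) \<Longrightarrow> k y = 0" for k e x
  proof -
    have "norm (LINT y|?M. k y * u y) \<le> (LINT y|?M. e * (indicator (cball x (r + 1)) y * \<bar>u y\<bar>))"
    proof (rule Bochner_Integration.integral_norm_bound_integral)
      show "integrable ?M (\<lambda>y. e * (indicator (cball x (r + 1)) y * \<bar>u y\<bar>))"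
        by (intro integrable_mult_right intB)
      show "norm (k y * u y) \<le> e * (indicator (cball x (r + 1)) y * \<bar>u y\<bar>)" for y
        using that(2,3)[of y] by (cases "y \<in> cball x (r + 1)") (auto simp: abs_mult mult_right_mono simp del: mem_cball)
    qed (rule that(1))
    then show ?thesis by simp
  qed
  \<comment> \<open>The summand \<open>1\<close> makes \<open>A x\<close> positive, so that it can serve as a denominator.\<close>
  define A where "A x = (LINT y|?M. indicator (cball x (r + 1)) y * \<bar>u y\<bar>) + 1" for x
  have A: "A x > 0" for x
    unfolding A_def by (rule add_nonneg_pos) (auto intro!: Bochner_Integration.integral_nonneg)
  have far: "norm (y - x') > r" if "y \<notin> cball x (r + 1)" "norm (x' - x) < 1" for x x' y
  proof -
    have "norm (y - x) \<le> norm (y - x') + norm (x' - x)" using norm_triangle_ineq[of "y - x'" "x' - x"] by simp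
    then show ?thesis using that by (simp add: dist_norm norm_minus_commute)
  qed
  show "((\<lambda>x. LINT y|?M. \<phi> (y - x) * u y) has_derivative (\<lambda>h. V x \<bullet> h)) (at x)"
    unfolding has_derivative_at_alt
  proof (intro conjI allI impI)
    show "bounded_linear (\<lambda>h. V x \<bullet> h)" by (rule bounded_linear_inner_right)
    fix e :: real assume e: "e > 0"
    obtain d where d: "d > 0" "d \<le> 1" "\<And>z z'. dist z' z < d \<Longrightarrow> dist (\<phi>' z') (\<phi>' z) < e / A x"
      using compact_support_uniformly_continuous[OF cont supp(2), of r "e / A x"] e A[of x] by auto
    show "\<exists>d>0. \<forall>x'. norm (x' - x) < d \<longrightarrow>
      norm ((LINT y|?M. \<phi> (y - x') * u y) - (LINT y|?M. \<phi> (y - x) * u y) - V x \<bullet> (x' - x)) \<le> e * norm (x' - x)"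
    proof (intro exI[of _ d] conjI allI impI)
      fix x' assume x': "norm (x' - x) < d"
      define k where "k y = \<phi> (y - x') - \<phi> (y - x) + \<phi>' (y - x) \<bullet> (x' - x)" for y
      have V: "V x \<bullet> (x' - x) = - (LINT y|?M. (\<phi>' (y - x) \<bullet> (x' - x)) * u y)"
        and iV: "integrable ?M (\<lambda>y. (\<phi>' (y - x) \<bullet> (x' - x)) * u y)"
      proof -
        have eq: "(\<phi>' (y - x) \<bullet> (x' - x)) * u y = (\<Sum>i\<in>UNIV. (x' - x) $ i * (\<phi>' (y - x) $ i * u y))" for y
          by (simp add: inner_vec_def sum_distrib_left sum_distrib_right mult_ac)
        show "integrable ?M (\<lambda>y. (\<phi>' (y - x) \<bullet> (x' - x)) * u y)"
          unfolding eq by (intro Bochner_Integration.integrable_sum integrable_mult_right int')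
        have "(LINT y|?M. (\<phi>' (y - x) \<bullet> (x' - x)) * u y) = (\<Sum>i\<in>UNIV. (x' - x) $ i * (LINT y|?M. \<phi>' (y - x) $ i * u y))"
          unfolding eq by (subst Bochner_Integration.integral_sum) (auto intro!: integrable_mult_right int')
        then show "V x \<bullet> (x' - x) = - (LINT y|?M. (\<phi>' (y - x) \<bullet> (x' - x)) * u y)"
          by (simp add: V_def inner_vec_def sum_negf mult.commute)
      qed
      have ku: "k y * u y = \<phi> (y - x') * u y - \<phi> (y - x) * u y + (\<phi>' (y - x) \<bullet> (x' - x)) * u y" for y
        by (simp add: k_def algebra_simps)
      have ik: "integrable ?M (\<lambda>y. k y * u y)"
        unfolding ku by (intro Bochner_Integration.integrable_add Bochner_Integration.integrable_diff int iV)
      have "(LINT y|?M. \<phi> (y - x') * u y) - (LINT y|?M. \<phi> (y - x) * u y) - V x \<bullet> (x' - x) = (LINT y|?M. k y * u y)"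
        unfolding ku V using int iV by simp
      also have "\<bar>\<dots>\<bar> \<le> (e / A x * norm (x' - x)) * (LINT y|?M. indicator (cball x (r + 1)) y * \<bar>u y\<bar>)"
      proof (rule bound[OF ik])
        fix y
        have "norm (\<phi> (y - x') - \<phi> (y - x) - \<phi>' (y - x) \<bullet> ((y - x') - (y - x))) \<le> norm ((y - x') - (y - x)) * (e / A x)"
        proof (rule differentiable_bound_linearization[where S="ball (y - x) d" and f'="\<lambda>z h. \<phi>' z \<bullet> h"])
          fix t :: real assume t: "t \<in> {0..1}"
          have "t * norm (x' - x) \<le> 1 * norm (x' - x)" using t by (intro mult_right_mono) auto
          then show "y - x + t *\<^sub>R (y - x' - (y - x)) \<in> ball (y - x) d"
            using t x' by (simp add: dist_norm norm_minus_commute)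
        next
          show "(\<phi> has_derivative (\<lambda>h. \<phi>' z \<bullet> h)) (at z within ball (y - x) d)" for z
            by (rule has_derivative_at_withinI[OF der])
        next
          fix z assume z: "z \<in> ball (y - x) d"
          show "onorm ((\<lambda>h. \<phi>' z \<bullet> h) - (\<lambda>h. \<phi>' (y - x) \<bullet> h)) \<le> e / A x"
            unfolding fun_diff_def
          proof (rule onorm_le)
            fix h
            have "norm (\<phi>' z \<bullet> h - \<phi>' (y - x) \<bullet> h) \<le> norm (\<phi>' z - \<phi>' (y - x)) * norm h"
              using Cauchy_Schwarz_ineq2[of "\<phi>' z - \<phi>' (y - x)" h] by (simp add: inner_diff_left)
            also have "\<dots> \<le> e / A x * norm h"
              using d(3)[of z "y - x"] z by (intro mult_right_mono) (auto simp: dist_norm norm_minus_commute)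
            finally show "norm (\<phi>' z \<bullet> h - \<phi>' (y - x) \<bullet> h) \<le> e / A x * norm h" .
          qed
        qed (use d in auto)
        then show "\<bar>k y\<bar> \<le> e / A x * norm (x' - x)"
          by (simp add: k_def inner_diff_right norm_minus_commute algebra_simps)
        show "k y = 0" if "y \<notin> cball x (r + 1)"
          using far[OF that, of x'] far[OF that, of x] x' d(2) by (simp add: k_def supp)
      qed
      also have "\<dots> \<le> (e / A x * norm (x' - x)) * A x"
        using e A[of x] by (intro mult_left_mono) (auto simp: A_def)
      also have "\<dots> = e * norm (x' - x)" using A[of x] by simp
      finally show "norm ((LINT y|?M. \<phi> (y - x') * u y) - (LINT y|?M. \<phi> (y - x) * u y) - V x \<bullet> (x' - x)) \<le> e * norm (x' - x)"
        by simp
    qed (rule d(1))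
  qed
  have "continuous_on UNIV (\<lambda>x. - (LINT y|?M. \<phi>' (y - x) $ i * u y))" for i
    unfolding continuous_on_iff
  proof (intro ballI allI impI)
    fix x and e :: real assume e: "e > 0"
    obtain d where d: "d > 0" "d \<le> 1" "\<And>z z'. dist z' z < d \<Longrightarrow> dist (\<phi>' z') (\<phi>' z) < e / A x"
      using compact_support_uniformly_continuous[OF cont supp(2), of r "e / A x"] e A[of x] by auto
    show "\<exists>d>0. \<forall>x'\<in>UNIV. dist x' x < d \<longrightarrow>
      dist (- (LINT y|?M. \<phi>' (y - x') $ i * u y)) (- (LINT y|?M. \<phi>' (y - x) $ i * u y)) < e"
    proof (intro exI[of _ d] conjI ballI impI)
      fix x' assume x': "dist x' x < d"
      have ku: "(\<phi>' (y - x') $ i - \<phi>' (y - x) $ i) * u y = \<phi>' (y - x') $ i * u y - \<phi>' (y - x) $ i * u y" for y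
        by (simp add: algebra_simps)
      have "(LINT y|?M. \<phi>' (y - x') $ i * u y) - (LINT y|?M. \<phi>' (y - x) $ i * u y) =
          (LINT y|?M. (\<phi>' (y - x') $ i - \<phi>' (y - x) $ i) * u y)"
        unfolding ku using int' by simp
      also have "\<bar>\<dots>\<bar> \<le> e / A x * (LINT y|?M. indicator (cball x (r + 1)) y * \<bar>u y\<bar>)"
      proof (rule bound)
        show "integrable ?M (\<lambda>y. (\<phi>' (y - x') $ i - \<phi>' (y - x) $ i) * u y)"
          unfolding ku by (intro Bochner_Integration.integrable_diff int')
        fix y
        have "\<bar>\<phi>' (y - x') $ i - \<phi>' (y - x) $ i\<bar> \<le> norm (\<phi>' (y - x') - \<phi>' (y - x))"
          using component_le_norm_cart[of "\<phi>' (y - x') - \<phi>' (y - x)" i] by simp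
        also have "\<dots> \<le> e / A x"
          using d(3)[of "y - x'" "y - x"] x' by (simp add: dist_norm norm_minus_commute)
        finally show "\<bar>\<phi>' (y - x') $ i - \<phi>' (y - x) $ i\<bar> \<le> e / A x" .
        show "\<phi>' (y - x') $ i - \<phi>' (y - x) $ i = 0" if "y \<notin> cball x (r + 1)"
          using far[OF that, of x'] far[OF that, of x] x' d(2) by (simp add: supp dist_norm)
      qed
      also have "\<dots> < e / A x * A x"
        using e A[of x] by (intro mult_strict_left_mono) (auto simp: A_def)
      also have "\<dots> = e" using A[of x] by simp
      finally show "dist (- (LINT y|?M. \<phi>' (y - x') $ i * u y)) (- (LINT y|?M. \<phi>' (y - x) $ i * u y)) < e"
        by (simp add: dist_real_def)
    qed (rule d(1))
  qed
  then show "continuous_on UNIV V"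
    unfolding V_def by (intro continuous_on_vec_lambda)
qed

section \<open>The Hilbert space of square-integrable four-tuples\<close>

definition L2 :: "(real^4) set \<Rightarrow> (4 \<Rightarrow> real^4 \<Rightarrow> real) set" where
  "L2 S = {f. \<forall>k. square_integrable_on S (f k)}"

definition l2_inner :: "(real^4) set \<Rightarrow> (4 \<Rightarrow> real^4 \<Rightarrow> real) \<Rightarrow> (4 \<Rightarrow> real^4 \<Rightarrow> real) \<Rightarrow> real" where
  "l2_inner S f g = (\<Sum>k\<in>UNIV. LINT x|lebesgue_on S. f k x * g k x)"

lemma L2_mult_integrable:
  "f \<in> L2 S \<Longrightarrow> g \<in> L2 S \<Longrightarrow> integrable (lebesgue_on S) (\<lambda>x. f k x * g l x)"
  by (simp add: L2_def square_integrable_mult)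

lemma L2_lincomb: "f \<in> L2 S \<Longrightarrow> g \<in> L2 S \<Longrightarrow> (\<lambda>k x. a * f k x + b * g k x) \<in> L2 S"
  by (simp add: L2_def square_integrable_add square_integrable_cmult)

lemma L2_diff: "f \<in> L2 S \<Longrightarrow> g \<in> L2 S \<Longrightarrow> (\<lambda>k x. f k x - g k x) \<in> L2 S"
  by (simp add: L2_def square_integrable_diff)

lemma l2_inner_eq_integral:
  assumes "f \<in> L2 S" "g \<in> L2 S"
  shows "l2_inner S f g = (LINT x|lebesgue_on S. f 0 x * g 0 x + f 1 x * g 1 x + f 2 x * g 2 x + f 3 x * g 3 x)"
  using L2_mult_integrable[OF assms] by (simp add: l2_inner_def sum_UNIV_4)

lemma CB_norm_eq:
  assumes "f \<in> L2 S" shows "CB_norm S f = sqrt (l2_inner S f f)"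
  using l2_inner_eq_integral[OF assms assms] by (simp add: CB_norm_def power2_eq_square)

lemma l2_inner_commute: "l2_inner S f g = l2_inner S g f"
  by (simp add: l2_inner_def mult.commute)

lemma l2_inner_nonneg: "0 \<le> l2_inner S f f"
  unfolding l2_inner_def by (intro sum_nonneg Bochner_Integration.integral_nonneg) simp

lemma l2_inner_lincomb_left:
  assumes "f \<in> L2 S" "g \<in> L2 S" "h \<in> L2 S"
  shows "l2_inner S (\<lambda>k x. a * f k x + b * g k x) h = a * l2_inner S f h + b * l2_inner S g h"
proof -
  have "(LINT x|lebesgue_on S. (a * f k x + b * g k x) * h k x) =
      a * (LINT x|lebesgue_on S. f k x * h k x) + b * (LINT x|lebesgue_on S. g k x * h k x)" for k
  proof -
    have "(\<lambda>x. (a * f k x + b * g k x) * h k x) = (\<lambda>x. a * (f k x * h k x) + b * (g k x * h k x))"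
      by (simp add: algebra_simps)
    then show ?thesis using L2_mult_integrable assms by simp
  qed
  then show ?thesis by (simp add: l2_inner_def sum.distrib sum_distrib_left)
qed

lemma l2_inner_diff_left:
  assumes "f \<in> L2 S" "g \<in> L2 S" "h \<in> L2 S"
  shows "l2_inner S (\<lambda>k x. f k x - g k x) h = l2_inner S f h - l2_inner S g h"
  using l2_inner_lincomb_left[OF assms, of 1 "-1"] by simp

lemma l2_inner_lincomb_self:
  assumes "f \<in> L2 S" "g \<in> L2 S"
  shows "l2_inner S (\<lambda>k x. a * f k x + b * g k x) (\<lambda>k x. a * f k x + b * g k x) =
    a\<^sup>2 * l2_inner S f f + 2 * a * b * l2_inner S f g + b\<^sup>2 * l2_inner S g g"
proof -
  let ?h = "\<lambda>k x. a * f k x + b * g k x"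
  have h: "?h \<in> L2 S" by (rule L2_lincomb[OF assms])
  have A: "l2_inner S f ?h = a * l2_inner S f f + b * l2_inner S f g"
    unfolding l2_inner_commute[of S f ?h] l2_inner_lincomb_left[OF assms assms(1)]
    by (simp only: l2_inner_commute[of S g f])
  have B: "l2_inner S g ?h = a * l2_inner S f g + b * l2_inner S g g"
    unfolding l2_inner_commute[of S g ?h] by (rule l2_inner_lincomb_left[OF assms assms(2)])
  have "l2_inner S ?h ?h = a * l2_inner S f ?h + b * l2_inner S g ?h"
    by (rule l2_inner_lincomb_left[OF assms h])
  also have "\<dots> = a\<^sup>2 * l2_inner S f f + 2 * a * b * l2_inner S f g + b\<^sup>2 * l2_inner S g g"
    unfolding A B by (simp add: power2_eq_square algebra_simps)
  finally show ?thesis .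
qed

text \<open>
  Nonnegativity of the form on \<open>a f + b g\<close>; where \<open>g\<close> has norm zero no minimising \<open>b\<close> exists and a
  large one is used instead.
\<close>

lemma l2_Cauchy_Schwarz_square:
  assumes "f \<in> L2 S" "g \<in> L2 S"
  shows "(l2_inner S f g)\<^sup>2 \<le> l2_inner S f f * l2_inner S g g"
proof -
  let ?c = "l2_inner S f g" and ?F = "l2_inner S f f" and ?G = "l2_inner S g g"
  have q: "0 \<le> a\<^sup>2 * ?F + 2 * a * b * ?c + b\<^sup>2 * ?G" for a b
    using l2_inner_nonneg[of S "\<lambda>k x. a * f k x + b * g k x"]
    unfolding l2_inner_lincomb_self[OF assms] by simp
  show ?thesis
  proof (cases "?G = 0")
    case True
    have "?c = 0"
    proof (rule ccontr)
      assume "?c \<noteq> 0"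
      then show False using q[of 1 "- (?F + 1) / ?c"] True l2_inner_nonneg[of S f] by simp
    qed
    then show ?thesis using True by simp
  next
    case False
    then have G: "?G > 0" using l2_inner_nonneg[of S g] by simp
    have "0 \<le> ?G * (?F * ?G - ?c\<^sup>2)"
      using q[of ?G "- ?c"] by (simp add: power2_eq_square algebra_simps)
    then show ?thesis using G by (simp add: zero_le_mult_iff)
  qed
qed

lemma l2_Cauchy_Schwarz:
  assumes "f \<in> L2 S" "g \<in> L2 S"
  shows "\<bar>l2_inner S f g\<bar> \<le> CB_norm S f * CB_norm S g"
proof -
  have "sqrt ((l2_inner S f g)\<^sup>2) \<le> sqrt (l2_inner S f f * l2_inner S g g)"
    using l2_Cauchy_Schwarz_square[OF assms] by (rule real_sqrt_le_mono)
  then show ?thesis using assms by (simp add: CB_norm_eq real_sqrt_mult)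
qed

lemma CB_norm_nonneg: "0 \<le> CB_norm S f"
  unfolding CB_norm_def by (intro real_sqrt_ge_zero Bochner_Integration.integral_nonneg) simp

lemma CB_norm_square: "f \<in> L2 S \<Longrightarrow> (CB_norm S f)\<^sup>2 = l2_inner S f f"
  by (simp add: CB_norm_eq l2_inner_nonneg)

lemma CB_norm_cmult:
  assumes "f \<in> L2 S" shows "CB_norm S (\<lambda>k x. c * f k x) = \<bar>c\<bar> * CB_norm S f"
proof -
  have L: "(\<lambda>k x. c * f k x) \<in> L2 S" using L2_lincomb[OF assms assms, of c 0] by simp
  have "l2_inner S (\<lambda>k x. c * f k x) (\<lambda>k x. c * f k x) = c\<^sup>2 * l2_inner S f f"
    using l2_inner_lincomb_self[OF assms assms, of c 0] by simp
  then show ?thesis using L assms by (simp add: CB_norm_eq real_sqrt_mult)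
qed

lemma CB_norm_triangle:
  assumes "f \<in> L2 S" "g \<in> L2 S"
  shows "CB_norm S (\<lambda>k x. f k x + g k x) \<le> CB_norm S f + CB_norm S g"
proof (rule power2_le_imp_le)
  have "(CB_norm S (\<lambda>k x. f k x + g k x))\<^sup>2 = (CB_norm S f)\<^sup>2 + 2 * l2_inner S f g + (CB_norm S g)\<^sup>2"
    using l2_inner_lincomb_self[OF assms, of 1 1] L2_lincomb[OF assms, of 1 1] assms
    by (simp add: CB_norm_square)
  also have "\<dots> \<le> (CB_norm S f + CB_norm S g)\<^sup>2"
    using l2_Cauchy_Schwarz[OF assms] by (simp add: power2_sum abs_le_iff)
  finally show "(CB_norm S (\<lambda>k x. f k x + g k x))\<^sup>2 \<le> (CB_norm S f + CB_norm S g)\<^sup>2" .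
qed (simp add: CB_norm_nonneg)

definition one_component :: "4 \<Rightarrow> (real^4 \<Rightarrow> real) \<Rightarrow> 4 \<Rightarrow> real^4 \<Rightarrow> real" where
  "one_component k u j = (if j = k then u else (\<lambda>x. 0))"

lemma one_component_L2: "square_integrable_on S u \<Longrightarrow> one_component k u \<in> L2 S"
  by (simp add: L2_def one_component_def)

lemma l2_inner_one_component: "l2_inner S (one_component k u) f = (LINT x|lebesgue_on S. u x * f k x)"
proof -
  have "(LINT x|lebesgue_on S. one_component k u j x * f j x) =
      (if k = j then LINT x|lebesgue_on S. u x * f k x else 0)" for j
    by (simp add: one_component_def)
  then show ?thesis by (simp add: l2_inner_def)
qed

text \<open>
  Convergence in norm lets integrals against a fixed kernel, applied to one component, pass to
  the limit.
\<close>

lemma integral_mult_tendsto: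
  assumes \<phi>: "square_integrable_on S \<phi>" and s: "\<And>n. s n \<in> L2 S" and G: "G \<in> L2 S"
    and lim: "(\<lambda>n. CB_norm S (\<lambda>k x. s n k x - G k x)) \<longlonglongrightarrow> 0"
  shows "(\<lambda>n. LINT x|lebesgue_on S. \<phi> x * s n k x) \<longlonglongrightarrow> (LINT x|lebesgue_on S. \<phi> x * G k x)"
proof -
  have "(\<lambda>n. l2_inner S (one_component k \<phi>) (s n) - l2_inner S (one_component k \<phi>) G) \<longlonglongrightarrow> 0"
  proof (rule Lim_null_comparison)
    show "(\<lambda>n. CB_norm S (one_component k \<phi>) * CB_norm S (\<lambda>k x. s n k x - G k x)) \<longlonglongrightarrow> 0"
      using tendsto_mult_left[OF lim, of "CB_norm S (one_component k \<phi>)"] by simp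
    have "\<bar>l2_inner S (one_component k \<phi>) (s n) - l2_inner S (one_component k \<phi>) G\<bar> \<le>
        CB_norm S (one_component k \<phi>) * CB_norm S (\<lambda>k x. s n k x - G k x)" for n
      using l2_Cauchy_Schwarz[OF one_component_L2[OF \<phi>, of k] L2_diff[OF s[of n] G]]
        l2_inner_diff_left[OF s[of n] G one_component_L2[OF \<phi>, of k]]
      by (simp add: l2_inner_commute)
    then show "\<forall>\<^sub>F n in sequentially. norm (l2_inner S (one_component k \<phi>) (s n) - l2_inner S (one_component k \<phi>) G) \<le>
        CB_norm S (one_component k \<phi>) * CB_norm S (\<lambda>k x. s n k x - G k x)" by simp
  qed
  then show ?thesis unfolding l2_inner_one_component by (simp add: LIM_zero_iff)
qed

text \<open>
  Closed balls of the Hilbert space are closed under pointwise limits. Applied to differences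
  \<open>s m - s n\<close> with \<open>m\<close> fixed it turns pointwise convergence of a Cauchy sequence into convergence in norm.
\<close>

lemma L2_Fatou:
  assumes s: "\<And>n. s n \<in> L2 S" and lim: "\<And>k x. x \<in> S \<Longrightarrow> (\<lambda>n. s n k x) \<longlonglongrightarrow> G k x"
    and bd: "\<And>n. n \<ge> N \<Longrightarrow> CB_norm S (s n) \<le> C"
  shows "G \<in> L2 S" "CB_norm S G \<le> C"
proof -
  let ?M = "lebesgue_on S"
  define w where "w f x = (f 0 x)\<^sup>2 + (f 1 x)\<^sup>2 + (f 2 x)\<^sup>2 + (f 3 x)\<^sup>2" for f :: "4 \<Rightarrow> real^4 \<Rightarrow> real" and x
  have C: "C \<ge> 0" using bd[of N] CB_norm_nonneg[of S "s N"] by simp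
  have sm: "s n k \<in> borel_measurable ?M" for n k
    using s[of n] by (simp add: L2_def square_integrable_on_def)
  have Gm: "G k \<in> borel_measurable ?M" for k
    by (rule borel_measurable_LIMSEQ_real[where u="\<lambda>n. s n k"]) (auto simp: lim sm)
  have wm: "w (s n) \<in> borel_measurable ?M" for n
    unfolding w_def[abs_def] using sm by measurable
  have wGm: "w G \<in> borel_measurable ?M"
    unfolding w_def[abs_def] using Gm by measurable
  have w0: "0 \<le> w f x" for f x by (simp add: w_def)
  have wi: "integrable ?M (w (s n))" for n
    using s[of n] unfolding w_def[abs_def] by (auto simp: L2_def square_integrable_on_def)
  have "(\<integral>\<^sup>+x. ennreal (w G x) \<partial>?M) = (\<integral>\<^sup>+x. liminf (\<lambda>n. ennreal (w (s n) x)) \<partial>?M)"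
  proof (rule nn_integral_cong)
    fix x assume "x \<in> space ?M"
    then have x: "x \<in> S" by simp
    have "(\<lambda>n. w (s n) x) \<longlonglongrightarrow> w G x"
      unfolding w_def by (intro tendsto_intros lim x)
    then have "(\<lambda>n. ennreal (w (s n) x)) \<longlonglongrightarrow> ennreal (w G x)" by (rule tendsto_ennrealI)
    then show "ennreal (w G x) = liminf (\<lambda>n. ennreal (w (s n) x))"
      by (simp add: lim_imp_Liminf)
  qed
  also have "\<dots> \<le> liminf (\<lambda>n. \<integral>\<^sup>+x. ennreal (w (s n) x) \<partial>?M)"
    by (rule nn_integral_liminf) (use wm in measurable)
  also have "\<dots> \<le> ennreal (C\<^sup>2)"
  proof (rule Liminf_le)
    have "(\<integral>\<^sup>+x. ennreal (w (s n) x) \<partial>?M) \<le> ennreal (C\<^sup>2)" if "n \<ge> N" for n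
    proof -
      have "(\<integral>\<^sup>+x. ennreal (w (s n) x) \<partial>?M) = ennreal (LINT x|?M. w (s n) x)"
        by (rule nn_integral_eq_integral[OF wi]) (simp add: w0)
      also have "(LINT x|?M. w (s n) x) = (CB_norm S (s n))\<^sup>2"
        unfolding CB_norm_def w_def by (simp add: Bochner_Integration.integral_nonneg)
      also have "ennreal \<dots> \<le> ennreal (C\<^sup>2)"
        by (intro ennreal_leI power_mono bd that CB_norm_nonneg)
      finally show ?thesis .
    qed
    then show "\<forall>\<^sub>F n in sequentially. (\<integral>\<^sup>+x. ennreal (w (s n) x) \<partial>?M) \<le> ennreal (C\<^sup>2)"
      using eventually_sequentially by blast
  qed simp
  finally have nn: "(\<integral>\<^sup>+x. ennreal (w G x) \<partial>?M) \<le> ennreal (C\<^sup>2)" .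
  have wGi: "integrable ?M (w G)"
    by (rule integrableI_nonneg[OF wGm]) (use nn w0 in \<open>auto intro: le_less_trans\<close>)
  have wle: "\<bar>G k x\<bar>\<^sup>2 \<le> w G x" for k x
  proof -
    have "\<forall>k. (G k x)\<^sup>2 \<le> w G x" unfolding all_4_iff w_def by simp
    then show ?thesis by simp
  qed
  have "square_integrable_on S (G k)" for k
    unfolding square_integrable_on_def
  proof (intro conjI Gm)
    show "integrable ?M (\<lambda>x. \<bar>G k x\<bar>\<^sup>2)"
    proof (rule Bochner_Integration.integrable_bound[OF wGi])
      show "(\<lambda>x. \<bar>G k x\<bar>\<^sup>2) \<in> borel_measurable ?M" using Gm by measurable
      show "AE x in ?M. norm (\<bar>G k x\<bar>\<^sup>2) \<le> norm (w G x)"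
        using wle w0 by (intro AE_I2) simp
    qed
  qed
  then show "G \<in> L2 S" by (simp add: L2_def)
  have "ennreal (LINT x|?M. w G x) \<le> ennreal (C\<^sup>2)"
    using nn nn_integral_eq_integral[OF wGi] w0 by simp
  then have "(LINT x|?M. w G x) \<le> C\<^sup>2" by simp
  then have "sqrt (LINT x|?M. w G x) \<le> C" using C by (rule real_le_lsqrt[rotated])
  then show "CB_norm S G \<le> C" by (simp add: CB_norm_def w_def)
qed

section \<open>Orthogonal projection\<close>

text \<open>
  The classical argument: a sequence in \<open>W\<close> minimising the distance to \<open>g\<close> is Cauchy by the parallelogram law,
  because the midpoint of two of its members lies in \<open>W\<close> and is no closer to \<open>g\<close> than the infimum. Its
  limit \<open>p\<close> attains the distance, and varying \<open>p\<close> in the direction \<open>f\<close> shows that \<open>g - p\<close> is orthogonal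
  to \<open>f\<close>.
\<close>

lemma orthogonal_projection:
  assumes W: "W \<subseteq> L2 S" "W \<noteq> {}"
    and lin: "\<And>f g a b. f \<in> W \<Longrightarrow> g \<in> W \<Longrightarrow> (\<lambda>k x. a * f k x + b * g k x) \<in> W"
    and complete: "\<And>s. (\<And>n. s n \<in> W) \<Longrightarrow>
        (\<And>e. e > 0 \<Longrightarrow> \<exists>M. \<forall>m\<ge>M. \<forall>n\<ge>M. CB_norm S (\<lambda>k x. s m k x - s n k x) < e) \<Longrightarrow>
        \<exists>p\<in>W. (\<lambda>n::nat. CB_norm S (\<lambda>k x. s n k x - p k x)) \<longlonglongrightarrow> 0"
    and g: "g \<in> L2 S"
  obtains p where "p \<in> W" "\<And>f. f \<in> W \<Longrightarrow> l2_inner S (\<lambda>k x. g k x - p k x) f = 0"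
proof -
  define D where "D f = l2_inner S (\<lambda>k x. g k x - f k x) (\<lambda>k x. g k x - f k x)" for f
  have WL: "f \<in> L2 S" if "f \<in> W" for f using W that by blast
  have gL: "(\<lambda>k x. g k x - f k x) \<in> L2 S" if "f \<in> W" for f by (rule L2_diff[OF g WL[OF that]])
  define d where "d = Inf (D ` W)"
  have bb: "bdd_below (D ` W)" by (rule bdd_belowI[of _ 0]) (auto simp: D_def l2_inner_nonneg)
  have d_le: "d \<le> D f" if "f \<in> W" for f unfolding d_def by (rule cInf_lower[OF _ bb]) (use that in auto)
  have d0: "d \<ge> 0" unfolding d_def using W(2) by (intro cInf_greatest) (auto simp: D_def l2_inner_nonneg)
  have "\<exists>f\<in>W. D f < d + 1 / (real n + 1)" for n
    using cInf_lessD[of "D ` W" "d + 1 / (real n + 1)"] W(2) by (auto simp: d_def)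
  then obtain s where s: "\<And>n. s n \<in> W" "\<And>n. D (s n) < d + 1 / (real n + 1)" by metis
  have par: "(CB_norm S (\<lambda>k x. s m k x - s n k x))\<^sup>2 \<le> 2 / (real m + 1) + 2 / (real n + 1)" for m n
  proof -
    let ?a = "\<lambda>k x. g k x - s m k x" and ?b = "\<lambda>k x. g k x - s n k x"
    have a: "?a \<in> L2 S" and b: "?b \<in> L2 S" using gL s by auto
    have mid: "(\<lambda>k x. (1/2) * s m k x + (1/2) * s n k x) \<in> W" by (intro lin s)
    have "D (\<lambda>k x. (1/2) * s m k x + (1/2) * s n k x) =
        l2_inner S (\<lambda>k x. (1/2) * ?a k x + (1/2) * ?b k x) (\<lambda>k x. (1/2) * ?a k x + (1/2) * ?b k x)"
      unfolding D_def by (rule arg_cong2[where f="l2_inner S"]) (auto simp: fun_eq_iff field_simps)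
    also have "\<dots> = (1/4) * D (s m) + (1/2) * l2_inner S ?a ?b + (1/4) * D (s n)"
      unfolding l2_inner_lincomb_self[OF a b] D_def by (simp add: power2_eq_square)
    finally have 1: "d \<le> (1/4) * D (s m) + (1/2) * l2_inner S ?a ?b + (1/4) * D (s n)"
      using d_le[OF mid] by simp
    have "(CB_norm S (\<lambda>k x. s m k x - s n k x))\<^sup>2 = l2_inner S (\<lambda>k x. s m k x - s n k x) (\<lambda>k x. s m k x - s n k x)"
      by (intro CB_norm_square L2_diff WL s)
    also have "\<dots> = l2_inner S (\<lambda>k x. (-1) * ?a k x + 1 * ?b k x) (\<lambda>k x. (-1) * ?a k x + 1 * ?b k x)"
      by simp
    also have "\<dots> = D (s m) - 2 * l2_inner S ?a ?b + D (s n)"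
      unfolding l2_inner_lincomb_self[OF a b] D_def by simp
    finally have 2: "(CB_norm S (\<lambda>k x. s m k x - s n k x))\<^sup>2 = D (s m) - 2 * l2_inner S ?a ?b + D (s n)" .
    have 3: "2 / (real i + 1) = 2 * (1 / (real i + 1))" for i by simp
    show ?thesis unfolding 2 3 using 1 s(2)[of m] s(2)[of n] by linarith
  qed
  have "\<exists>p\<in>W. (\<lambda>n::nat. CB_norm S (\<lambda>k x. s n k x - p k x)) \<longlonglongrightarrow> 0"
  proof (rule complete[OF s(1)])
    fix e :: real assume e: "e > 0"
    obtain M :: nat where M: "4 / e\<^sup>2 < real M" using reals_Archimedean2 by blast
    have "CB_norm S (\<lambda>k x. s m k x - s n k x) < e" if "m \<ge> M" "n \<ge> M" for m n
    proof (rule power2_less_imp_less)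
      have "2 / (real i + 1) < e\<^sup>2 / 2" if "i \<ge> M" for i
      proof -
        have "4 / e\<^sup>2 < real i + 1" using M that by linarith
        then have "4 < (real i + 1) * e\<^sup>2" using e by (simp add: pos_divide_less_eq)
        then show ?thesis by (simp add: pos_divide_less_eq algebra_simps)
      qed
      from this[OF that(1)] this[OF that(2)] show "(CB_norm S (\<lambda>k x. s m k x - s n k x))\<^sup>2 < e\<^sup>2"
        using par[of m n] by linarith
    qed (use e in simp)
    then show "\<exists>M. \<forall>m\<ge>M. \<forall>n\<ge>M. CB_norm S (\<lambda>k x. s m k x - s n k x) < e" by blast
  qed
  then obtain p where p: "p \<in> W" "(\<lambda>n. CB_norm S (\<lambda>k x. s n k x - p k x)) \<longlonglongrightarrow> 0" by blast
  have "CB_norm S (\<lambda>k x. g k x - p k x) \<le> sqrt d"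
  proof (rule LIMSEQ_le[OF tendsto_const])
    have "(\<lambda>n. 1 / (real n + 1)) \<longlonglongrightarrow> 0"
      using LIMSEQ_inverse_real_of_nat by (simp add: divide_inverse add.commute)
    then have "(\<lambda>n. sqrt (d + 1 / (real n + 1)) + CB_norm S (\<lambda>k x. s n k x - p k x)) \<longlonglongrightarrow> sqrt (d + 0) + 0"
      by (intro tendsto_intros p(2))
    then show "(\<lambda>n. sqrt (d + 1 / (real n + 1)) + CB_norm S (\<lambda>k x. s n k x - p k x)) \<longlonglongrightarrow> sqrt d" by simp
    have "CB_norm S (\<lambda>k x. g k x - p k x) \<le> sqrt (d + 1 / (real n + 1)) + CB_norm S (\<lambda>k x. s n k x - p k x)" for n
    proof -
      have "CB_norm S (\<lambda>k x. g k x - p k x) \<le> CB_norm S (\<lambda>k x. g k x - s n k x) + CB_norm S (\<lambda>k x. s n k x - p k x)"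
        using CB_norm_triangle[OF gL[OF s(1)[of n]] L2_diff[OF WL[OF s(1)[of n]] WL[OF p(1)]]] by simp
      moreover have "CB_norm S (\<lambda>k x. g k x - s n k x) \<le> sqrt (d + 1 / (real n + 1))"
        using s(2)[of n] gL[OF s(1)[of n]] by (simp add: CB_norm_eq D_def)
      ultimately show ?thesis by linarith
    qed
    then show "\<exists>N. \<forall>n\<ge>N. CB_norm S (\<lambda>k x. g k x - p k x) \<le> sqrt (d + 1 / (real n + 1)) + CB_norm S (\<lambda>k x. s n k x - p k x)"
      by blast
  qed
  then have Dp: "D p \<le> d" using gL[OF p(1)] by (simp add: CB_norm_eq D_def)
  show thesis
  proof (rule that[OF p(1)])
    fix f assume f: "f \<in> W"
    let ?v = "\<lambda>k x. g k x - p k x"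
    let ?c = "l2_inner S ?v f" and ?F = "l2_inner S f f"
    have F: "?F \<ge> 0" by (rule l2_inner_nonneg)
    have le: "2 * t * ?c \<le> t\<^sup>2 * ?F" for t
    proof -
      have "(\<lambda>k x. 1 * p k x + t * f k x) \<in> W" by (intro lin p f)
      from d_le[OF this] have "D p \<le> D (\<lambda>k x. 1 * p k x + t * f k x)" using Dp by linarith
      also have "\<dots> = l2_inner S (\<lambda>k x. 1 * ?v k x + (- t) * f k x) (\<lambda>k x. 1 * ?v k x + (- t) * f k x)"
        by (simp add: D_def diff_diff_eq)
      also have "\<dots> = D p - 2 * t * ?c + t\<^sup>2 * ?F"
        unfolding l2_inner_lincomb_self[OF gL[OF p(1)] WL[OF f]] by (simp add: D_def)
      finally show ?thesis by simp
    qed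
    \<comment> \<open>If \<open>?c \<noteq> 0\<close>, then \<open>le\<close> fails for every \<open>t\<close> strictly between \<open>0\<close> and \<open>2 * ?c / ?F\<close>; this one avoids dividing by \<open>0\<close>.\<close>
    define t where "t = ?c / (?F + 1)"
    have c: "?c = t * (?F + 1)" using F by (simp add: t_def)
    have "2 * t\<^sup>2 * (?F + 1) \<le> t\<^sup>2 * ?F" using le[of t] unfolding c by (simp add: power2_eq_square mult.assoc)
    then have "t\<^sup>2 * (?F + 2) \<le> 0" by (simp add: algebra_simps)
    then have "t = 0" using F by (simp add: mult_le_0_iff)
    then show "?c = 0" using c by simp
  qed
qed

section \<open>The space of solutions\<close>

lemma CB_L2: "f \<in> CB q \<Omega> \<Longrightarrow> f \<in> L2 \<Omega>"
  by (simp add: CB_def L2_def)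

lemma pd_lincomb:
  assumes "u differentiable (at x)" "v differentiable (at x)"
  shows "pd i (\<lambda>x. a * u x + b * v x) x = a * pd i u x + b * pd i v x"
proof -
  have "((\<lambda>x. a * u x + b * v x) has_derivative (\<lambda>h. (a *\<^sub>R grad u x + b *\<^sub>R grad v x) \<bullet> h)) (at x)"
    using has_derivative_grad[OF assms(1)] has_derivative_grad[OF assms(2)]
    by (auto intro!: derivative_eq_intros simp: inner_simps)
  from pd_eq_of_has_derivative[OF this] show ?thesis by simp
qed

lemma C1_on_lincomb:
  assumes "C1_on S u" "C1_on S v" shows "C1_on S (\<lambda>x. a * u x + b * v x)"
proof (rule C1_onI)
  show "((\<lambda>x. a * u x + b * v x) has_derivative (\<lambda>h. (a *\<^sub>R grad u x + b *\<^sub>R grad v x) \<bullet> h)) (at x)" if "x \<in> S" for x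
    using assms that by (auto simp: C1_on_iff_grad inner_simps intro!: derivative_eq_intros)
  show "continuous_on S (\<lambda>x. a *\<^sub>R grad u x + b *\<^sub>R grad v x)"
    using assms by (auto simp: C1_on_iff_grad intro!: continuous_intros)
qed

lemma cimmino_system_lincomb:
  assumes f: "\<And>k. C1_on \<Omega> (f k)" "cimmino_system q \<Omega> f"
    and g: "\<And>k. C1_on \<Omega> (g k)" "cimmino_system q \<Omega> g"
  shows "cimmino_system q \<Omega> (\<lambda>k x. a * f k x + b * g k x)"
  unfolding cimmino_system_def
proof
  fix x assume x: "x \<in> \<Omega>"
  have pd: "pd i (\<lambda>x. a * f k x + b * g k x) x = a * pd i (f k) x + b * pd i (g k) x" for i k
    using f(1)[of k] g(1)[of k] x by (intro pd_lincomb) (auto simp: C1_on_def)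
  have solve: "pd 0 (h 0) x = q$0 * h 0 x + q$2 * h 2 x - q$1 * h 1 x - q$3 * h 3 x
        - pd 2 (h 2) x + pd 1 (h 1) x + pd 3 (h 3) x"
      "pd 1 (h 0) x = q$1 * h 0 x + q$0 * h 1 x - q$3 * h 2 x - q$2 * h 3 x
        - pd 0 (h 1) x + pd 3 (h 2) x + pd 2 (h 3) x"
      "pd 2 (h 0) x = q$2 * h 0 x + q$1 * h 3 x - q$3 * h 1 x - q$0 * h 2 x
        - pd 1 (h 3) x + pd 3 (h 1) x + pd 0 (h 2) x"
      "pd 3 (h 0) x = q$3 * h 0 x + q$2 * h 1 x + q$1 * h 2 x + q$0 * h 3 x
        - pd 2 (h 1) x - pd 1 (h 2) x - pd 0 (h 3) x" if "cimmino_system q \<Omega> h" for h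
    using that[unfolded cimmino_system_def, rule_format, OF x] by linarith+
  let ?h = "\<lambda>k x. a * f k x + b * g k x"
  show "pd 0 (?h 0) x + pd 2 (?h 2) x - pd 1 (?h 1) x - pd 3 (?h 3) x
       = q$0 * ?h 0 x + q$2 * ?h 2 x - q$1 * ?h 1 x - q$3 * ?h 3 x \<and>
     pd 1 (?h 0) x + pd 0 (?h 1) x - pd 3 (?h 2) x - pd 2 (?h 3) x
       = q$1 * ?h 0 x + q$0 * ?h 1 x - q$3 * ?h 2 x - q$2 * ?h 3 x \<and>
     pd 2 (?h 0) x + pd 1 (?h 3) x - pd 3 (?h 1) x - pd 0 (?h 2) x
       = q$2 * ?h 0 x + q$1 * ?h 3 x - q$3 * ?h 1 x - q$0 * ?h 2 x \<and>
     pd 3 (?h 0) x + pd 2 (?h 1) x + pd 1 (?h 2) x + pd 0 (?h 3) x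
       = q$3 * ?h 0 x + q$2 * ?h 1 x + q$1 * ?h 2 x + q$0 * ?h 3 x"
    unfolding pd solve[OF f(2)] solve[OF g(2)] by (simp add: algebra_simps)
qed

lemma CB_lincomb:
  assumes "f \<in> CB q \<Omega>" "g \<in> CB q \<Omega>" shows "(\<lambda>k x. a * f k x + b * g k x) \<in> CB q \<Omega>"
  using assms
  by (auto simp: CB_def C1_on_lincomb square_integrable_add square_integrable_cmult
      intro!: cimmino_system_lincomb)

lemma CB_0: "(\<lambda>k x. 0) \<in> CB q \<Omega>"
proof -
  have "C1_on \<Omega> (\<lambda>x. 0)" by (rule C1_onI[where v="\<lambda>x. 0"]) auto
  moreover have "pd i (\<lambda>x. 0) x = 0" for i x
    using pd_eq_of_has_derivative[of "\<lambda>x. 0" 0 x i] by simp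
  ultimately show ?thesis by (simp add: CB_def cimmino_system_def)
qed

lemma CB_diff:
  assumes "f \<in> CB q \<Omega>" "g \<in> CB q \<Omega>" shows "(\<lambda>k x. f k x - g k x) \<in> CB q \<Omega>"
  using CB_lincomb[OF assms, of 1 "-1"] by simp

lemma L2_rmul:
  assumes "f \<in> L2 S" shows "rmul_i f \<in> L2 S" "rmul_j f \<in> L2 S" "rmul_k f \<in> L2 S"
  using assms by (auto simp: L2_def rmul_defs tuple4_def square_integrable_uminus)

lemma CB_rmul:
  assumes "f \<in> CB q \<Omega>"
  shows "rmul_i f \<in> CB q \<Omega>" "rmul_j f \<in> CB q \<Omega>" "rmul_k f \<in> CB q \<Omega>"
proof -
  have f: "\<And>k. C1_on \<Omega> (f k)" "cimmino_system q \<Omega> f" "\<And>k x. x \<notin> \<Omega> \<Longrightarrow> f k x = 0"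
    using assms by (auto simp: CB_def)
  have "rmul_i f k x = 0" "rmul_j f k x = 0" "rmul_k f k x = 0" if "x \<notin> \<Omega>" for k x
    using f(3)[OF that] by (auto simp: rmul_defs tuple4_def)
  then show "rmul_i f \<in> CB q \<Omega>" "rmul_j f \<in> CB q \<Omega>" "rmul_k f \<in> CB q \<Omega>"
    using L2_rmul[OF CB_L2[OF assms]] C1_on_rmul[OF f(1)] cimmino_system_rmul[OF f(1,2)]
    by (auto simp: CB_def L2_def)
qed

section \<open>Interior estimates and completeness\<close>

lemma mollifier_square_integrable:
  assumes S: "S \<in> sets lebesgue" and r: "r > 0"
  shows "square_integrable_on S (\<lambda>y. mollifier q r (y - x))"
    and "square_integrable_on S (\<lambda>y. mollifier_grad q r (y - x) $ i)"
proof -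
  have c: "continuous_on UNIV (mollifier q r)"
    by (intro continuous_at_imp_continuous_on ballI has_derivative_continuous[OF mollifier_has_derivative[OF r]])
  show "square_integrable_on S (\<lambda>y. mollifier q r (y - x))"
    by (rule square_integrable_compact_support[OF S, of _ x r])
       (auto intro!: continuous_on_compose2[OF c] continuous_intros mollifier_support[OF r] simp: dist_norm norm_minus_commute)
  show "square_integrable_on S (\<lambda>y. mollifier_grad q r (y - x) $ i)"
    by (rule square_integrable_compact_support[OF S, of _ x r])
       (auto intro!: continuous_on_compose2[OF continuous_mollifier_grad] continuous_intros
         simp: mollifier_support[OF r] dist_norm norm_minus_commute)
qed

text \<open>
  The radius can be kept constant near \<open>x\<close>: for \<open>z\<close> within half the distance \<open>e\<close>, the ball of radius
  \<open>4 (e / 8)\<close> around \<open>z\<close> stays inside. With a fixed kernel both sides can be differentiated in \<open>z\<close>.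
\<close>

lemma CB_locally_reproduced:
  assumes \<Omega>: "open \<Omega>" and x: "x \<in> \<Omega>"
  obtains r d where "r > 0" "d > 0" "ball x d \<subseteq> \<Omega>"
    "\<And>f k z. \<lbrakk>f \<in> CB q \<Omega>; z \<in> ball x d\<rbrakk> \<Longrightarrow> f k z = (LINT y|lebesgue_on \<Omega>. mollifier q r (y - z) * f k y)"
proof -
  obtain e where e: "e > 0" "cball x e \<subseteq> \<Omega>" using \<Omega> x open_contains_cball by blast
  show thesis
  proof (rule that[of "e / 8" "e / 2"])
    show "ball x (e / 2) \<subseteq> \<Omega>" using e by (intro subset_trans[OF _ e(2)]) auto
    fix f k z assume f: "f \<in> CB q \<Omega>" and z: "z \<in> ball x (e / 2)"
    have "cball z (4 * (e / 8)) \<subseteq> cball x e"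
    proof
      fix y assume "y \<in> cball z (4 * (e / 8))"
      then show "y \<in> cball x e" using z dist_triangle[of x y z] by simp
    qed
    then have "cball z (4 * (e / 8)) \<subseteq> \<Omega>" using e(2) by (rule subset_trans)
    from mollifier_reproduces[OF \<Omega> _ _ this, of f q k] f e(1)
    show "f k z = (LINT y|lebesgue_on \<Omega>. mollifier q (e / 8) (y - z) * f k y)"
      by (simp add: CB_def)
  qed (use e in auto)
qed

text \<open>
  Any square-integrable function that satisfies the formula, in particular a limit of
  solutions, is \<open>C\<^sup>1\<close>, with derivatives that depend continuously on it in norm.
\<close>

lemma reproduced_imp_C1:
  assumes S: "S \<in> sets lebesgue" and r: "r > 0" and u: "square_integrable_on S u" and U: "open U"
    and rep: "\<And>z. z \<in> U \<Longrightarrow> u z = (LINT y|lebesgue_on S. mollifier q r (y - z) * u y)"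
  shows "C1_on U u"
    and "\<And>z. z \<in> U \<Longrightarrow> pd i u z = - (LINT y|lebesgue_on S. mollifier_grad q r (y - z) $ i * u y)"
proof -
  note conv = convolution_C1[OF S u mollifier_has_derivative[OF r] continuous_mollifier_grad
      mollifier_support(1)[OF r] mollifier_support(2)[OF r]]
  define V where "V = (\<lambda>z. \<chi> i. - (LINT y|lebesgue_on S. mollifier_grad q r (y - z) $ i * u y))"
  have der: "(u has_derivative (\<lambda>h. V z \<bullet> h)) (at z)" if "z \<in> U" for z
  proof (rule has_derivative_transform_within_open[OF _ U that])
    show "((\<lambda>z. LINT y|lebesgue_on S. mollifier q r (y - z) * u y) has_derivative (\<lambda>h. V z \<bullet> h)) (at z)"
      unfolding V_def by (rule conv(1))
  qed (rule rep[symmetric])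
  have "continuous_on UNIV V" using conv(2) unfolding V_def .
  then have "continuous_on U V" by (rule continuous_on_subset) simp
  with der show "C1_on U u" by (rule C1_onI)
  show "pd i u z = - (LINT y|lebesgue_on S. mollifier_grad q r (y - z) $ i * u y)" if "z \<in> U" for z
    using pd_eq_of_has_derivative[OF der[OF that]] by (simp add: V_def)
qed

lemma C1_on_local:
  assumes "\<And>x. x \<in> S \<Longrightarrow> \<exists>U. open U \<and> x \<in> U \<and> C1_on U u"
  shows "C1_on S u"
proof -
  have "isCont (pd i u) x" and "u differentiable (at x)" if x: "x \<in> S" for x i
  proof -
    obtain U where "open U" "x \<in> U" "C1_on U u" using assms[OF x] by blast
    then show "isCont (pd i u) x" "u differentiable (at x)"
      using continuous_on_eq_continuous_at[of U "pd i u"] by (auto simp: C1_on_def)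
  qed
  then show ?thesis
    unfolding C1_on_def by (auto intro!: continuous_at_imp_continuous_on)
qed

text \<open>
  The reproducing formula and the Cauchy-Schwarz inequality.
\<close>

lemma CB_evaluation_bounded:
  assumes \<Omega>: "open \<Omega>" and x: "x \<in> \<Omega>"
  obtains C where "C > 0" "\<And>f. f \<in> CB q \<Omega> \<Longrightarrow> \<bar>f k x\<bar> \<le> C * CB_norm \<Omega> f"
proof -
  have S: "\<Omega> \<in> sets lebesgue" using \<Omega> by (auto intro: borel_open)
  obtain r d where r: "r > 0" "d > 0" "ball x d \<subseteq> \<Omega>"
    "\<And>f k z. \<lbrakk>f \<in> CB q \<Omega>; z \<in> ball x d\<rbrakk> \<Longrightarrow> f k z = (LINT y|lebesgue_on \<Omega>. mollifier q r (y - z) * f k y)"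
    by (rule CB_locally_reproduced[OF \<Omega> x, of q]) blast
  let ?m = "one_component k (\<lambda>y. mollifier q r (y - x))"
  have m: "?m \<in> L2 \<Omega>" by (rule one_component_L2[OF mollifier_square_integrable(1)[OF S r(1)]])
  show thesis
  proof (rule that[of "CB_norm \<Omega> ?m + 1"])
    show "CB_norm \<Omega> ?m + 1 > 0" using CB_norm_nonneg[of \<Omega> ?m] by linarith
    fix f assume f: "f \<in> CB q \<Omega>"
    have "\<bar>f k x\<bar> = \<bar>l2_inner \<Omega> ?m f\<bar>" using r(4)[OF f, of x k] r(2) by (simp add: l2_inner_one_component)
    also have "\<dots> \<le> CB_norm \<Omega> ?m * CB_norm \<Omega> f" by (rule l2_Cauchy_Schwarz[OF m CB_L2[OF f]])
    also have "\<dots> \<le> (CB_norm \<Omega> ?m + 1) * CB_norm \<Omega> f"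
      by (intro mult_right_mono CB_norm_nonneg) simp
    finally show "\<bar>f k x\<bar> \<le> (CB_norm \<Omega> ?m + 1) * CB_norm \<Omega> f" .
  qed
qed

text \<open>
  The pointwise limit inherits the reproducing formula, hence is \<open>C\<^sup>1\<close>, and its derivatives are the
  limits of the derivatives of the sequence, hence it satisfies the system.
\<close>

lemma CB_complete:
  assumes \<Omega>: "open \<Omega>" and s: "\<And>n. s n \<in> CB q \<Omega>"
    and cauchy: "\<And>e. e > 0 \<Longrightarrow> \<exists>M. \<forall>m\<ge>M. \<forall>n\<ge>M. CB_norm \<Omega> (\<lambda>k x. s m k x - s n k x) < e"
  shows "\<exists>G\<in>CB q \<Omega>. (\<lambda>n::nat. CB_norm \<Omega> (\<lambda>k x. s n k x - G k x)) \<longlonglongrightarrow> 0"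
proof -
  have S: "\<Omega> \<in> sets lebesgue" using \<Omega> by (auto intro: borel_open)
  have sL: "s n \<in> L2 \<Omega>" for n by (rule CB_L2[OF s])
  define G where "G k x = (if x \<in> \<Omega> then lim (\<lambda>n. s n k x) else 0)" for k x
  have lim: "(\<lambda>n. s n k x) \<longlonglongrightarrow> G k x" if x: "x \<in> \<Omega>" for k x
  proof -
    obtain C where C: "C > 0" "\<And>f. f \<in> CB q \<Omega> \<Longrightarrow> \<bar>f k x\<bar> \<le> C * CB_norm \<Omega> f"
      by (rule CB_evaluation_bounded[OF \<Omega> x, of q k]) blast
    have "Cauchy (\<lambda>n. s n k x)"
      unfolding Cauchy_def
    proof (intro allI impI)
      fix e :: real assume e: "e > 0"
      then obtain M where M: "\<And>m n. m \<ge> M \<Longrightarrow> n \<ge> M \<Longrightarrow> CB_norm \<Omega> (\<lambda>k x. s m k x - s n k x) < e / C"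
        using cauchy[of "e / C"] C(1) by auto
      have "dist (s m k x) (s n k x) < e" if "m \<ge> M" "n \<ge> M" for m n
      proof -
        have "\<bar>s m k x - s n k x\<bar> \<le> C * CB_norm \<Omega> (\<lambda>k x. s m k x - s n k x)"
          using C(2)[OF CB_diff[OF s[of m] s[of n]]] .
        also have "\<dots> < C * (e / C)" using M[OF that] C(1) by (intro mult_strict_left_mono)
        finally show ?thesis using C(1) by (simp add: dist_real_def)
      qed
      then show "\<exists>M. \<forall>m\<ge>M. \<forall>n\<ge>M. dist (s m k x) (s n k x) < e" by blast
    qed
    then show ?thesis using x by (simp add: G_def Cauchy_convergent_iff convergent_LIMSEQ_iff)
  qed
  have tail: "\<exists>M. \<forall>m\<ge>M. (\<lambda>k x. s m k x - G k x) \<in> L2 \<Omega> \<and> CB_norm \<Omega> (\<lambda>k x. s m k x - G k x) \<le> e"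
    if e: "e > 0" for e
  proof -
    obtain M where M: "\<And>m n. m \<ge> M \<Longrightarrow> n \<ge> M \<Longrightarrow> CB_norm \<Omega> (\<lambda>k x. s m k x - s n k x) < e"
      using cauchy[OF e] by blast
    have "(\<lambda>k x. s m k x - G k x) \<in> L2 \<Omega> \<and> CB_norm \<Omega> (\<lambda>k x. s m k x - G k x) \<le> e" if m: "m \<ge> M" for m
    proof -
      have L: "(\<lambda>k x. s m k x - s n k x) \<in> L2 \<Omega>" for n by (rule L2_diff[OF sL sL])
      have l: "(\<lambda>n. s m k x - s n k x) \<longlonglongrightarrow> s m k x - G k x" if "x \<in> \<Omega>" for k x
        by (intro tendsto_intros lim that)
      have b: "CB_norm \<Omega> (\<lambda>k x. s m k x - s n k x) \<le> e" if "n \<ge> M" for n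
        using M[OF m that] by simp
      show ?thesis using L2_Fatou[OF L l b] by blast
    qed
    then show ?thesis by blast
  qed
  obtain M1 where "(\<lambda>k x. s M1 k x - G k x) \<in> L2 \<Omega>" using tail[of 1] by auto
  from L2_diff[OF sL[of M1] this] have GL: "G \<in> L2 \<Omega>" by simp
  have conv: "(\<lambda>n. CB_norm \<Omega> (\<lambda>k x. s n k x - G k x)) \<longlonglongrightarrow> 0"
  proof (rule LIMSEQ_I)
    fix e :: real assume "e > 0"
    then obtain M where "\<And>m. m \<ge> M \<Longrightarrow> CB_norm \<Omega> (\<lambda>k x. s m k x - G k x) \<le> e / 2"
      using tail[of "e / 2"] by auto
    then show "\<exists>no. \<forall>n\<ge>no. norm (CB_norm \<Omega> (\<lambda>k x. s n k x - G k x) - 0) < e"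
      using \<open>e > 0\<close> CB_norm_nonneg by (intro exI[of _ M]) (force intro: le_less_trans)
  qed
  have local: "\<exists>U. open U \<and> x \<in> U \<and> C1_on U (G k) \<and> (\<forall>i. (\<lambda>n. pd i (s n k) x) \<longlonglongrightarrow> pd i (G k) x)"
    if x: "x \<in> \<Omega>" for x k
  proof -
    obtain r d where r: "r > 0" "d > 0" "ball x d \<subseteq> \<Omega>"
      "\<And>f k z. \<lbrakk>f \<in> CB q \<Omega>; z \<in> ball x d\<rbrakk> \<Longrightarrow> f k z = (LINT y|lebesgue_on \<Omega>. mollifier q r (y - z) * f k y)"
      by (rule CB_locally_reproduced[OF \<Omega> x, of q]) blast
    have Gk: "square_integrable_on \<Omega> (G k)" using GL by (simp add: L2_def)
    have sk: "square_integrable_on \<Omega> (s n k)" for n using sL[of n] by (simp add: L2_def)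
    have rep: "G k z = (LINT y|lebesgue_on \<Omega>. mollifier q r (y - z) * G k y)" if z: "z \<in> ball x d" for z
    proof (rule LIMSEQ_unique)
      show "(\<lambda>n. s n k z) \<longlonglongrightarrow> G k z" using lim z r(3) by blast
      show "(\<lambda>n. s n k z) \<longlonglongrightarrow> (LINT y|lebesgue_on \<Omega>. mollifier q r (y - z) * G k y)"
        unfolding r(4)[OF s z]
        by (rule integral_mult_tendsto[OF mollifier_square_integrable(1)[OF S r(1)] sL GL conv])
    qed
    note C1G = reproduced_imp_C1[OF S r(1) Gk open_ball rep]
    note C1s = reproduced_imp_C1[OF S r(1) sk open_ball r(4)[OF s]]
    have "(\<lambda>n. pd i (s n k) x) \<longlonglongrightarrow> pd i (G k) x" for i
    proof -
      have xb: "x \<in> ball x d" using r(2) by simp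
      show ?thesis
        unfolding C1G(2)[OF _ xb, simplified] C1s(2)[OF _ xb, simplified]
        by (intro tendsto_minus integral_mult_tendsto[OF mollifier_square_integrable(2)[OF S r(1)] sL GL conv])
    qed
    then show ?thesis using C1G(1) r(2) by (intro exI[of _ "ball x d"]) auto
  qed
  have "cimmino_system q \<Omega> G"
    unfolding cimmino_system_def
  proof
    fix x assume x: "x \<in> \<Omega>"
    have p: "(\<lambda>n. pd i (s n k) x) \<longlonglongrightarrow> pd i (G k) x" for i k using local[OF x] by blast
    note v = lim[OF x]
    have lim_eq: "L = R" if "A = B" "A \<longlonglongrightarrow> L" "B \<longlonglongrightarrow> R" for A B :: "nat \<Rightarrow> real" and L R
      using that LIMSEQ_unique by blast
    have sys: "(\<lambda>n. pd 0 (s n 0) x + pd 2 (s n 2) x - pd 1 (s n 1) x - pd 3 (s n 3) x) =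
        (\<lambda>n. q$0 * s n 0 x + q$2 * s n 2 x - q$1 * s n 1 x - q$3 * s n 3 x)"
      "(\<lambda>n. pd 1 (s n 0) x + pd 0 (s n 1) x - pd 3 (s n 2) x - pd 2 (s n 3) x) =
        (\<lambda>n. q$1 * s n 0 x + q$0 * s n 1 x - q$3 * s n 2 x - q$2 * s n 3 x)"
      "(\<lambda>n. pd 2 (s n 0) x + pd 1 (s n 3) x - pd 3 (s n 1) x - pd 0 (s n 2) x) =
        (\<lambda>n. q$2 * s n 0 x + q$1 * s n 3 x - q$3 * s n 1 x - q$0 * s n 2 x)"
      "(\<lambda>n. pd 3 (s n 0) x + pd 2 (s n 1) x + pd 1 (s n 2) x + pd 0 (s n 3) x) =
        (\<lambda>n. q$3 * s n 0 x + q$2 * s n 1 x + q$1 * s n 2 x + q$0 * s n 3 x)"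
      using s x by (auto simp: fun_eq_iff CB_def cimmino_system_def)
    show "pd 0 (G 0) x + pd 2 (G 2) x - pd 1 (G 1) x - pd 3 (G 3) x
       = q$0 * G 0 x + q$2 * G 2 x - q$1 * G 1 x - q$3 * G 3 x \<and>
     pd 1 (G 0) x + pd 0 (G 1) x - pd 3 (G 2) x - pd 2 (G 3) x
       = q$1 * G 0 x + q$0 * G 1 x - q$3 * G 2 x - q$2 * G 3 x \<and>
     pd 2 (G 0) x + pd 1 (G 3) x - pd 3 (G 1) x - pd 0 (G 2) x
       = q$2 * G 0 x + q$1 * G 3 x - q$3 * G 1 x - q$0 * G 2 x \<and>
     pd 3 (G 0) x + pd 2 (G 1) x + pd 1 (G 2) x + pd 0 (G 3) x
       = q$3 * G 0 x + q$2 * G 1 x + q$1 * G 2 x + q$0 * G 3 x"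
      by (rule conjI[OF lim_eq[OF sys(1)] conjI[OF lim_eq[OF sys(2)]
            conjI[OF lim_eq[OF sys(3)] lim_eq[OF sys(4)]]]])
         (intro tendsto_intros p v)+
  qed
  moreover have "C1_on \<Omega> (G k)" for k by (rule C1_on_local) (use local in blast)
  ultimately have "G \<in> CB q \<Omega>" using GL by (simp add: CB_def L2_def G_def)
  then show ?thesis using conv by blast
qed

section \<open>Reproducing kernels\<close>

text \<open>
  The components of \<open>f\<^sup>* g\<close> are recovered from real parts: the \<open>i\<close>-component of a quaternion \<open>a\<close> is minus
  the real part of \<open>a i\<close>.
\<close>

lemma CB_form_eq_l2_inner:
  assumes "f \<in> L2 S" "g \<in> L2 S"
  shows "CB_form S f g = tuple4 (l2_inner S f g) (- l2_inner S f (rmul_i g))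
    (- l2_inner S f (rmul_j g)) (- l2_inner S f (rmul_k g))"
proof -
  have neg: "(LINT x|lebesgue_on S. f 0 x * h 0 x + f 1 x * h 1 x + f 2 x * h 2 x + f 3 x * h 3 x) = l2_inner S f h"
    if "h \<in> L2 S" for h using l2_inner_eq_integral[OF assms(1) that] by simp
  have "(LINT x|lebesgue_on S. f 0 x * g 1 x - f 1 x * g 0 x - f 2 x * g 3 x + f 3 x * g 2 x) = - l2_inner S f (rmul_i g)"
    unfolding neg[OF L2_rmul(1)[OF assms(2)], symmetric] Bochner_Integration.integral_minus[symmetric]
    by (simp add: rmul_defs algebra_simps)
  moreover have "(LINT x|lebesgue_on S. f 0 x * g 2 x - f 3 x * g 1 x + f 1 x * g 3 x - f 2 x * g 0 x) = - l2_inner S f (rmul_j g)"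
    unfolding neg[OF L2_rmul(2)[OF assms(2)], symmetric] Bochner_Integration.integral_minus[symmetric]
    by (simp add: rmul_defs algebra_simps)
  moreover have "(LINT x|lebesgue_on S. f 0 x * g 3 x - f 1 x * g 2 x + f 2 x * g 1 x - f 3 x * g 0 x) = - l2_inner S f (rmul_k g)"
    unfolding neg[OF L2_rmul(3)[OF assms(2)], symmetric] Bochner_Integration.integral_minus[symmetric]
    by (simp add: rmul_defs algebra_simps)
  ultimately show ?thesis unfolding CB_form_def using neg[OF assms(2)] by simp
qed

text \<open>
  Right multiplication by a unit is skew-adjoint, since the conjugate of a unit is its negative.
\<close>

lemma l2_inner_rmul:
  assumes "f \<in> L2 S" "g \<in> L2 S"
  shows "l2_inner S f (rmul_i g) = - l2_inner S (rmul_i f) g"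
    and "l2_inner S f (rmul_j g) = - l2_inner S (rmul_j f) g"
    and "l2_inner S f (rmul_k g) = - l2_inner S (rmul_k f) g"
  unfolding l2_inner_eq_integral[OF assms(1) L2_rmul(1)[OF assms(2)]] l2_inner_eq_integral[OF L2_rmul(1)[OF assms(1)] assms(2)]
    l2_inner_eq_integral[OF assms(1) L2_rmul(2)[OF assms(2)]] l2_inner_eq_integral[OF L2_rmul(2)[OF assms(1)] assms(2)]
    l2_inner_eq_integral[OF assms(1) L2_rmul(3)[OF assms(2)]] l2_inner_eq_integral[OF L2_rmul(3)[OF assms(1)] assms(2)]
    Bochner_Integration.integral_minus[symmetric]
  by (simp_all add: rmul_defs algebra_simps)

lemma CB_form_conjugate_symmetric:
  assumes "f \<in> L2 S" "g \<in> L2 S"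
  shows "CB_form S f g = tuple4 (CB_form S g f 0) (- CB_form S g f 1) (- CB_form S g f 2) (- CB_form S g f 3)"
  unfolding CB_form_eq_l2_inner[OF assms] CB_form_eq_l2_inner[OF assms(2,1)] l2_inner_rmul[OF assms]
  by (simp add: l2_inner_commute)

lemma CB_projection:
  assumes \<Omega>: "open \<Omega>" and g: "g \<in> L2 \<Omega>"
  obtains p where "p \<in> CB q \<Omega>" "\<And>f. f \<in> CB q \<Omega> \<Longrightarrow> l2_inner \<Omega> f g = l2_inner \<Omega> f p"
proof -
  obtain p where p: "p \<in> CB q \<Omega>" "\<And>f. f \<in> CB q \<Omega> \<Longrightarrow> l2_inner \<Omega> (\<lambda>k x. g k x - p k x) f = 0"
  proof (rule orthogonal_projection[OF _ _ _ _ g, of "CB q \<Omega>"])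
    show "CB q \<Omega> \<subseteq> L2 \<Omega>" using CB_L2 by blast
    show "CB q \<Omega> \<noteq> {}" using CB_0 by blast
    show "(\<lambda>k x. a * f k x + b * g k x) \<in> CB q \<Omega>" if "f \<in> CB q \<Omega>" "g \<in> CB q \<Omega>" for f g a b
      by (rule CB_lincomb[OF that])
    show "\<exists>p\<in>CB q \<Omega>. (\<lambda>n::nat. CB_norm \<Omega> (\<lambda>k x. s n k x - p k x)) \<longlonglongrightarrow> 0"
      if "\<And>n. s n \<in> CB q \<Omega>" "\<And>e. e > 0 \<Longrightarrow> \<exists>M. \<forall>m\<ge>M. \<forall>n\<ge>M. CB_norm \<Omega> (\<lambda>k x. s m k x - s n k x) < e" for s
      by (rule CB_complete[OF \<Omega> that])
  qed blast
  show thesis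
  proof (rule that[OF p(1)])
    fix f assume f: "f \<in> CB q \<Omega>"
    show "l2_inner \<Omega> f g = l2_inner \<Omega> f p"
      using p(2)[OF f] l2_inner_diff_left[OF g CB_L2[OF p(1)] CB_L2[OF f]]
        l2_inner_commute[of \<Omega> f g] l2_inner_commute[of \<Omega> f p] by simp
  qed
qed

text \<open>
  The real orthogonal projection is quaternionic: all four components of the form are real inner products
  with \<open>f\<close>, \<open>f i\<close>, \<open>f j\<close> or \<open>f k\<close>, and these lie in the space together with \<open>f\<close>.
\<close>

lemma CB_form_projection:
  assumes f: "f \<in> CB q \<Omega>" and g: "g \<in> L2 \<Omega>" and p: "p \<in> L2 \<Omega>"
    and proj: "\<And>f. f \<in> CB q \<Omega> \<Longrightarrow> l2_inner \<Omega> f g = l2_inner \<Omega> f p"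
  shows "CB_form \<Omega> f g = CB_form \<Omega> f p"
  unfolding CB_form_eq_l2_inner[OF CB_L2[OF f] g] CB_form_eq_l2_inner[OF CB_L2[OF f] p]
    l2_inner_rmul[OF CB_L2[OF f] g] l2_inner_rmul[OF CB_L2[OF f] p]
    proj[OF f] proj[OF CB_rmul(1)[OF f]] proj[OF CB_rmul(2)[OF f]] proj[OF CB_rmul(3)[OF f]] ..

text \<open>
  Evaluation of \<open>f 0\<close> at \<open>x\<close> is the inner product with the local kernel placed in component \<open>0\<close>,
  so \<open>K\<close> is the projection of that kernel. The other components follow by applying this to \<open>f i\<close>, \<open>f j\<close> and \<open>f k\<close>.
\<close>

lemma CB_reproducing_element:
  assumes \<Omega>: "open \<Omega>" and x: "x \<in> \<Omega>"
  obtains K where "K \<in> CB q \<Omega>" "\<And>f. f \<in> CB q \<Omega> \<Longrightarrow> CB_form \<Omega> K f = (\<lambda>k. f k x)"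
proof -
  have S: "\<Omega> \<in> sets lebesgue" using \<Omega> by (auto intro: borel_open)
  obtain r d where r: "r > 0" "d > 0" "ball x d \<subseteq> \<Omega>"
    "\<And>f k z. \<lbrakk>f \<in> CB q \<Omega>; z \<in> ball x d\<rbrakk> \<Longrightarrow> f k z = (LINT y|lebesgue_on \<Omega>. mollifier q r (y - z) * f k y)"
    by (rule CB_locally_reproduced[OF \<Omega> x, of q]) blast
  let ?m = "one_component 0 (\<lambda>y. mollifier q r (y - x))"
  have m: "?m \<in> L2 \<Omega>" by (rule one_component_L2[OF mollifier_square_integrable(1)[OF S r(1)]])
  obtain K where K: "K \<in> CB q \<Omega>" "\<And>f. f \<in> CB q \<Omega> \<Longrightarrow> l2_inner \<Omega> f ?m = l2_inner \<Omega> f K"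
    by (rule CB_projection[OF \<Omega> m, of q]) blast
  have eval: "l2_inner \<Omega> K f = f 0 x" if f: "f \<in> CB q \<Omega>" for f
  proof -
    have "l2_inner \<Omega> K f = l2_inner \<Omega> ?m f"
      using K(2)[OF f] by (simp only: l2_inner_commute[of \<Omega> f])
    also have "\<dots> = f 0 x" using r(4)[OF f, of x 0] r(2) by (simp add: l2_inner_one_component)
    finally show ?thesis .
  qed
  show thesis
  proof (rule that[OF K(1)])
    fix f assume f: "f \<in> CB q \<Omega>"
    show "CB_form \<Omega> K f = (\<lambda>k. f k x)"
      unfolding CB_form_eq_l2_inner[OF CB_L2[OF K(1)] CB_L2[OF f]] fun_eq_iff all_4_iff
        eval[OF f] eval[OF CB_rmul(1)[OF f]] eval[OF CB_rmul(2)[OF f]] eval[OF CB_rmul(3)[OF f]]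
      by (simp add: rmul_defs)
  qed
qed

lemma CB_real_banach_space:
  assumes \<Omega>: "open \<Omega>"
  shows "real_banach_space (CB q \<Omega>) (CB_norm \<Omega>)"
  unfolding real_banach_space_def
proof (intro conjI ballI allI impI)
  show "(\<lambda>k x. 0) \<in> CB q \<Omega>" by (rule CB_0)
next
  fix f g assume f: "f \<in> CB q \<Omega>" and g: "g \<in> CB q \<Omega>"
  show "(\<lambda>k x. f k x + g k x) \<in> CB q \<Omega>" using CB_lincomb[OF f g, of 1 1] by simp
  show "CB_norm \<Omega> (\<lambda>k x. f k x + g k x) \<le> CB_norm \<Omega> f + CB_norm \<Omega> g"
    by (rule CB_norm_triangle[OF CB_L2[OF f] CB_L2[OF g]])
next
  fix c f assume f: "f \<in> CB q \<Omega>"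
  show "(\<lambda>k x. c * f k x) \<in> CB q \<Omega>" using CB_lincomb[OF f f, of c 0] by simp
  show "CB_norm \<Omega> (\<lambda>k x. c * f k x) = \<bar>c\<bar> * CB_norm \<Omega> f"
    by (rule CB_norm_cmult[OF CB_L2[OF f]])
next
  fix f assume f: "f \<in> CB q \<Omega>"
  show "0 \<le> CB_norm \<Omega> f" by (rule CB_norm_nonneg)
  show "CB_norm \<Omega> f = 0 \<longleftrightarrow> f = (\<lambda>k x. 0)"
  proof
    assume n: "CB_norm \<Omega> f = 0"
    have "f k x = 0" for k x
    proof (cases "x \<in> \<Omega>")
      case True
      obtain C where "C > 0" "\<And>f. f \<in> CB q \<Omega> \<Longrightarrow> \<bar>f k x\<bar> \<le> C * CB_norm \<Omega> f"
        by (rule CB_evaluation_bounded[OF \<Omega> True, of q k]) blast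
      from this(2)[OF f] show ?thesis by (simp add: n)
    qed (use f in \<open>simp add: CB_def\<close>)
    then show "f = (\<lambda>k x. 0)" by (simp add: fun_eq_iff)
  qed (simp add: CB_norm_def)
next
  fix s :: "nat \<Rightarrow> 4 \<Rightarrow> real^4 \<Rightarrow> real"
  assume s: "(\<forall>n. s n \<in> CB q \<Omega>) \<and>
    (\<forall>e>0. \<exists>M. \<forall>m\<ge>M. \<forall>n\<ge>M. CB_norm \<Omega> (\<lambda>k x. s m k x - s n k x) < e)"
  show "\<exists>f\<in>CB q \<Omega>. (\<lambda>n. CB_norm \<Omega> (\<lambda>k x. s n k x - f k x)) \<longlonglongrightarrow> 0"
    by (rule CB_complete[OF \<Omega>]) (use s in blast)+
qed

theorem proposition3p5:
  fixes \<Omega> :: "(real^4) set" and q :: "real^4"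
  assumes "open \<Omega>" and "connected \<Omega>" and "\<Omega> \<noteq> {}"
  shows "real_banach_space (CB q \<Omega>) (CB_norm \<Omega>) \<and>
    (\<exists>B0 B1 B2 B3 :: real^4 \<Rightarrow> real^4 \<Rightarrow> real.
      (\<forall>x\<in>\<Omega>. tuple4 (\<lambda>y. B0 x y) (\<lambda>y. - B1 x y) (\<lambda>y. - B2 x y) (\<lambda>y. - B3 x y) \<in> CB q \<Omega>) \<and>
      (\<forall>y\<in>\<Omega>. tuple4 (\<lambda>x. B0 x y) (\<lambda>x. B1 x y) (\<lambda>x. B2 x y) (\<lambda>x. B3 x y) \<in> CB q \<Omega>) \<and>
      (\<forall>f\<in>CB q \<Omega>. \<forall>x\<in>\<Omega>.
        CB_form \<Omega> (tuple4 (\<lambda>y. B0 x y) (\<lambda>y. - B1 x y) (\<lambda>y. - B2 x y) (\<lambda>y. - B3 x y)) f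
          = tuple4 (f 0 x) (f 1 x) (f 2 x) (f 3 x)) \<and>
      (\<forall>f\<in>CB q \<Omega>. \<forall>x\<in>\<Omega>.
        (LINT y|lebesgue_on \<Omega>. B0 x y * f 0 y - B1 x y * f 1 y - B2 x y * f 2 y - B3 x y * f 3 y)
          = f 0 x \<and>
        (LINT y|lebesgue_on \<Omega>. B0 x y * f 1 y + B1 x y * f 0 y + B2 x y * f 3 y - B3 x y * f 2 y)
          = f 1 x \<and>
        (LINT y|lebesgue_on \<Omega>. B0 x y * f 2 y - B1 x y * f 3 y + B2 x y * f 0 y + B3 x y * f 1 y)
          = f 2 x \<and>
        (LINT y|lebesgue_on \<Omega>. B0 x y * f 3 y + B1 x y * f 2 y - B2 x y * f 1 y + B3 x y * f 0 y)
          = f 3 x) \<and>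
      (\<forall>g :: 4 \<Rightarrow> real^4 \<Rightarrow> real. (\<forall>k. square_integrable_on \<Omega> (g k)) \<longrightarrow>
        (\<lambda>k x. if x \<in> \<Omega>
           then CB_form \<Omega> (tuple4 (\<lambda>y. B0 x y) (\<lambda>y. - B1 x y) (\<lambda>y. - B2 x y) (\<lambda>y. - B3 x y)) g k
           else 0) \<in> CB q \<Omega>))"
proof (intro conjI, goal_cases)
  case 1
  show ?case by (rule CB_real_banach_space[OF assms(1)])
next
  case 2
  note \<Omega> = assms(1)
  have "\<forall>x\<in>\<Omega>. \<exists>K. K \<in> CB q \<Omega> \<and> (\<forall>f\<in>CB q \<Omega>. CB_form \<Omega> K f = (\<lambda>k. f k x))"
  proof
    fix x assume "x \<in> \<Omega>"
    then obtain K where "K \<in> CB q \<Omega>" "\<And>f. f \<in> CB q \<Omega> \<Longrightarrow> CB_form \<Omega> K f = (\<lambda>k. f k x)"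
      by (rule CB_reproducing_element[OF \<Omega>, of _ q]) blast
    then show "\<exists>K. K \<in> CB q \<Omega> \<and> (\<forall>f\<in>CB q \<Omega>. CB_form \<Omega> K f = (\<lambda>k. f k x))"
      by (intro exI[of _ K] conjI ballI)
  qed
  from bchoice[OF this] obtain K0 where "\<forall>x\<in>\<Omega>. K0 x \<in> CB q \<Omega> \<and>
      (\<forall>f\<in>CB q \<Omega>. CB_form \<Omega> (K0 x) f = (\<lambda>k. f k x))" by (rule exE)
  then have K0: "K0 x \<in> CB q \<Omega>" "f \<in> CB q \<Omega> \<Longrightarrow> CB_form \<Omega> (K0 x) f = (\<lambda>k. f k x)"
    if "x \<in> \<Omega>" for x f using that by simp_all
  \<comment> \<open>The value \<open>0\<close> for \<open>x\<close> outside \<open>\<Omega>\<close> makes \<open>x \<mapsto> B x y\<close> vanish there, as membership in the space requires.\<close>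
  define K where "K x = (if x \<in> \<Omega> then K0 x else (\<lambda>k y. 0))" for x
  have K: "K x \<in> CB q \<Omega>" if "x \<in> \<Omega>" for x using K0(1)[OF that] that by (simp add: K_def)
  have rep: "CB_form \<Omega> (K x) f = (\<lambda>k. f k x)" if "x \<in> \<Omega>" "f \<in> CB q \<Omega>" for x f
    using K0(2)[OF that] that by (simp add: K_def)
  let ?B0 = "\<lambda>x y. K x 0 y" and ?B1 = "\<lambda>x y. - K x 1 y" and ?B2 = "\<lambda>x y. - K x 2 y" and ?B3 = "\<lambda>x y. - K x 3 y"
  have tup: "tuple4 (\<lambda>y. ?B0 x y) (\<lambda>y. - ?B1 x y) (\<lambda>y. - ?B2 x y) (\<lambda>y. - ?B3 x y) = K x" for x
    unfolding fun_eq_iff all_4_iff by simp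
  \<comment> \<open>Conjugate symmetry of the form, evaluated at the pair \<open>K x\<close>, \<open>K y\<close>.\<close>
  have swap: "tuple4 (\<lambda>x. ?B0 x y) (\<lambda>x. ?B1 x y) (\<lambda>x. ?B2 x y) (\<lambda>x. ?B3 x y) = K y" if y: "y \<in> \<Omega>" for y
  proof -
    have "tuple4 (K x 0 y) (- K x 1 y) (- K x 2 y) (- K x 3 y) = (\<lambda>k. K y k x)" for x
    proof (cases "x \<in> \<Omega>")
      case True
      from CB_form_conjugate_symmetric[OF CB_L2[OF K[OF True]] CB_L2[OF K[OF y]]] show ?thesis
        unfolding rep[OF True K[OF y]] rep[OF y K[OF True]] by (rule sym)
    next
      case False
      then have "K y k x = 0" for k using K[OF y] by (simp add: CB_def)
      moreover have "K x k y = 0" for k using False by (simp add: K_def)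
      ultimately show ?thesis unfolding fun_eq_iff all_4_iff tuple4_simps by simp
    qed
    then have "\<forall>k. tuple4 (K x 0 y) (- K x 1 y) (- K x 2 y) (- K x 3 y) k = K y k x" for x by simp
    then show ?thesis unfolding fun_eq_iff all_4_iff tuple4_simps by simp
  qed
  show ?case
  proof (rule exI[of _ ?B0], rule exI[of _ ?B1], rule exI[of _ ?B2], rule exI[of _ ?B3], intro conjI)
  show "\<forall>x\<in>\<Omega>. tuple4 (\<lambda>y. ?B0 x y) (\<lambda>y. - ?B1 x y) (\<lambda>y. - ?B2 x y) (\<lambda>y. - ?B3 x y) \<in> CB q \<Omega>"
    unfolding tup using K by blast
  show "\<forall>y\<in>\<Omega>. tuple4 (\<lambda>x. ?B0 x y) (\<lambda>x. ?B1 x y) (\<lambda>x. ?B2 x y) (\<lambda>x. ?B3 x y) \<in> CB q \<Omega>"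
    using swap K by simp
  have reproduce: "CB_form \<Omega> (tuple4 (\<lambda>y. ?B0 x y) (\<lambda>y. - ?B1 x y) (\<lambda>y. - ?B2 x y) (\<lambda>y. - ?B3 x y)) f
      = tuple4 (f 0 x) (f 1 x) (f 2 x) (f 3 x)" if "f \<in> CB q \<Omega>" "x \<in> \<Omega>" for f x
    unfolding tup rep[OF that(2,1)] unfolding fun_eq_iff all_4_iff by simp
  then show "\<forall>f\<in>CB q \<Omega>. \<forall>x\<in>\<Omega>.
      CB_form \<Omega> (tuple4 (\<lambda>y. ?B0 x y) (\<lambda>y. - ?B1 x y) (\<lambda>y. - ?B2 x y) (\<lambda>y. - ?B3 x y)) f
        = tuple4 (f 0 x) (f 1 x) (f 2 x) (f 3 x)" by blast
  show "\<forall>f\<in>CB q \<Omega>. \<forall>x\<in>\<Omega>.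
        (LINT y|lebesgue_on \<Omega>. ?B0 x y * f 0 y - ?B1 x y * f 1 y - ?B2 x y * f 2 y - ?B3 x y * f 3 y)
          = f 0 x \<and>
        (LINT y|lebesgue_on \<Omega>. ?B0 x y * f 1 y + ?B1 x y * f 0 y + ?B2 x y * f 3 y - ?B3 x y * f 2 y)
          = f 1 x \<and>
        (LINT y|lebesgue_on \<Omega>. ?B0 x y * f 2 y - ?B1 x y * f 3 y + ?B2 x y * f 0 y + ?B3 x y * f 1 y)
          = f 2 x \<and>
        (LINT y|lebesgue_on \<Omega>. ?B0 x y * f 3 y + ?B1 x y * f 2 y - ?B2 x y * f 1 y + ?B3 x y * f 0 y)
          = f 3 x"
  proof (intro ballI)
    fix f x assume f: "f \<in> CB q \<Omega>" and x: "x \<in> \<Omega>"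
    have "\<forall>k. CB_form \<Omega> (K x) f k = f k x" using rep[OF x f] by simp
    then show "(LINT y|lebesgue_on \<Omega>. ?B0 x y * f 0 y - ?B1 x y * f 1 y - ?B2 x y * f 2 y - ?B3 x y * f 3 y)
          = f 0 x \<and>
        (LINT y|lebesgue_on \<Omega>. ?B0 x y * f 1 y + ?B1 x y * f 0 y + ?B2 x y * f 3 y - ?B3 x y * f 2 y)
          = f 1 x \<and>
        (LINT y|lebesgue_on \<Omega>. ?B0 x y * f 2 y - ?B1 x y * f 3 y + ?B2 x y * f 0 y + ?B3 x y * f 1 y)
          = f 2 x \<and>
        (LINT y|lebesgue_on \<Omega>. ?B0 x y * f 3 y + ?B1 x y * f 2 y - ?B2 x y * f 1 y + ?B3 x y * f 0 y)
          = f 3 x"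
      unfolding all_4_iff CB_form_def tuple4_simps by (simp add: algebra_simps)
  qed
  show "\<forall>g :: 4 \<Rightarrow> real^4 \<Rightarrow> real. (\<forall>k. square_integrable_on \<Omega> (g k)) \<longrightarrow>
        (\<lambda>k x. if x \<in> \<Omega>
           then CB_form \<Omega> (tuple4 (\<lambda>y. ?B0 x y) (\<lambda>y. - ?B1 x y) (\<lambda>y. - ?B2 x y) (\<lambda>y. - ?B3 x y)) g k
           else 0) \<in> CB q \<Omega>"
  proof (intro allI impI)
    fix g :: "4 \<Rightarrow> real^4 \<Rightarrow> real" assume "\<forall>k. square_integrable_on \<Omega> (g k)"
    then have g: "g \<in> L2 \<Omega>" by (simp add: L2_def)
    obtain p where p: "p \<in> CB q \<Omega>" "\<And>f. f \<in> CB q \<Omega> \<Longrightarrow> l2_inner \<Omega> f g = l2_inner \<Omega> f p"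
      by (rule CB_projection[OF \<Omega> g, of q]) blast
    have "CB_form \<Omega> (K x) g = (\<lambda>k. p k x)" if "x \<in> \<Omega>" for x
      using CB_form_projection[OF K[OF that] g CB_L2[OF p(1)] p(2)] rep[OF that p(1)] by (rule trans)
    moreover have "p k x = 0" if "x \<notin> \<Omega>" for k x using p(1) that by (simp add: CB_def)
    ultimately have "(\<lambda>k x. if x \<in> \<Omega> then CB_form \<Omega> (K x) g k else 0) = p"
      by (simp add: fun_eq_iff)
    then show "(\<lambda>k x. if x \<in> \<Omega>
           then CB_form \<Omega> (tuple4 (\<lambda>y. ?B0 x y) (\<lambda>y. - ?B1 x y) (\<lambda>y. - ?B2 x y) (\<lambda>y. - ?B3 x y)) g k
           else 0) \<in> CB q \<Omega>"
      unfolding tup using p(1) by simp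
  qed
  qed
qed

end
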